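(* For the self-similar solutions with rotation speed $c$ and expanding speed $d$, if $(c,d)\neq(0,0)$, the behavior of the solution can be separated into 3 cases: Case 1: Undercritical case ($c^2<4(1-d)$). The solution is unique up to rotation and scaling. It behaves like a cycloid which moves along a logarithmic spiral or a circle. There are infinitely many cusps on the solution. With $K=\sqrt{1-d-\frac{c^2}{4}}$, an explicit parametrization is $$x=e^{(\frac{c}{2}+(K+1)i)\theta}\Big((1-K)i-\frac{c}{2}\Big)+e^{(\frac{c}{2}+(1-K)i)\theta}\Big((1+K)i-\frac{c}{2}\Big).$$ Case 2: Critical case ($c^2=4(1-d)$). Up to rotation and scaling, there are 2 different solutions. One of them is a logarithmic spiral; the other one has a cusp and is asymptotic to the logarithmic spiral near the origin. Explicit parametrizations are, respectively, $$x=e^{(\frac{c}{2}+i)\theta},\qquad x=\Big(-\frac{c}{2}+i\Big)\theta e^{(\frac{c}{2}+i)\theta}-e^{(\frac{c}{2}+i)\theta}.$$ Case 3: Overcritical case ($c^2>4(1-d)$). Up to rotation and scaling, there are 4 different solutions. 2 of them are logarithmic spirals; the other 2 are asymptotic to the logarithmic spirals in both ends of the solution. One of the latter 2 solutions has a cusp, the other is smooth. With $K=\sqrt{\frac{c^2}{4}+d-1}$, explicit parametrizations are, for the logarithmic spirals, $$x=e^{(\frac{c}{2}+K+i)\theta},\qquad x=e^{(\frac{c}{2}-K+i)\theta},$$ and, for the other 2 solutions, $$x=e^{(\frac{c}{2}+K+i)\theta}\Big(i-\frac{c}{2}-K\Big)+e^{(\frac{c}{2}-K+i)\theta}\Big(i-\frac{c}{2}+K\Big),$$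 $$x=e^{(\frac{c}{2}+K+i)\theta}\Big(i-\frac{c}{2}-K\Big)-e^{(\frac{c}{2}-K+i)\theta}\Big(i-\frac{c}{2}+K\Big).$$
   Context: $\mathbb{R}^2$ is identified with $\mathbb{C}$, so that rotation is multiplication by a complex number of absolute value one and scaling is multiplication by a positive real number; $\langle\cdot,\cdot\rangle$ is the Euclidean inner product. For a curve $x$ with arc length parameter $s$, $T$ is the unit tangent vector, $N$ is the unit normal obtained by rotating $T$ counter-clockwise by $\frac{\pi}{2}$, and $k=\langle\frac{dT}{ds},N\rangle=-H$ is the signed curvature, $H$ being the mean curvature. The inverse mean curvature flow is $\frac{dx}{dt}=\frac1H N$, used in the form $\langle\partial_t x,N\rangle=-\frac1k$. A self-similar solution with rotation speed $c$ and expanding speed $d$ ($c,d$ real) is a solution moving by scaling and rotation, expressed as $e^{(d+ci)t}x(s)$ with initial curve $x(s)$ satisfying $c\langle x,T\rangle-d\langle x,N\rangle=\frac1k$; any rotation and scaling of such a curve is again a solution with the same $c$ and $d$. Curves are allowed to pass through singular points where $c\langle x,T\rangle-d\langle x,N\rangle=0$, i.e. where the curvature is infinite. In the parametrizations, the parameter $\theta$ is, up to a rotation, the direction angle of the unit tangent vector of the curve.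
   Formalization: In Case 2, "asymptotic to the logarithmic spiral near the origin" is stated only for c≠0: for c=0, d=1 the second curve has |x|²=1+θ² and never nears the origin. Where a "logarithmic spiral" has growth rate 0 (Case 2 with c=0, Case 3 with d=1) it is stated to be a circle. *)

theory Defs
  imports "HOL-Analysis.Analysis" "HOL-Library.Landau_Symbols"
begin

section \<open>Planar curves with cusps\<close>

text \<open>
  Curves are maps from the whole real line to the complex plane; since every open interval is
  diffeomorphic to the line, no other parameter domains are needed.

  A curve that passes through a cusp has no continuous forward unit tangent \<open>dx/ds\<close>; what
  continues through the cusp is the tangent up to sign. Hence the unit tangent \<open>T\<close> is a
  separate field with \<open>x' = v T\<close>, where the signed speed \<open>v\<close> may vanish and change sign. The
  arc length is then oriented by \<open>ds = v du\<close>. Where \<open>v < 0\<close> this reverses \<open>s\<close>, \<open>T\<close>, \<open>N\<close> and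
  \<open>k\<close> simultaneously, and the equation of self-similar solutions below is invariant under that.
\<close>

definition unit_tangent_along :: "(real \<Rightarrow> complex) \<Rightarrow> (real \<Rightarrow> complex) \<Rightarrow> bool" where
  "unit_tangent_along x T \<longleftrightarrow>
     (\<forall>u. x differentiable (at u) \<and> T differentiable (at u) \<and> norm (T u) = 1 \<and>
          (\<exists>v. vector_derivative x (at u) = v *\<^sub>R T u))"

definition normal :: "(real \<Rightarrow> complex) \<Rightarrow> real \<Rightarrow> complex" where
  "normal T u = \<i> * T u"

text \<open>\<open>k = \<langle>dT/ds, N\<rangle>\<close> with \<open>ds/du = \<langle>x'(u), T(u)\<rangle>\<close>; meaningful only where \<open>x'(u) \<noteq> 0\<close>.\<close>

definition signed_curvature :: "(real \<Rightarrow> complex) \<Rightarrow> (real \<Rightarrow> complex) \<Rightarrow> real \<Rightarrow> real" where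
  "signed_curvature x T u =
     (vector_derivative T (at u) \<bullet> normal T u) / (vector_derivative x (at u) \<bullet> T u)"

definition cusp :: "(real \<Rightarrow> complex) \<Rightarrow> real \<Rightarrow> bool" where
  "cusp x u \<longleftrightarrow>
     (\<exists>\<tau>. norm \<tau> = 1 \<and>
        ((\<lambda>w. sgn (vector_derivative x (at w))) \<longlongrightarrow> \<tau>) (at_right u) \<and>
        ((\<lambda>w. sgn (vector_derivative x (at w))) \<longlongrightarrow> - \<tau>) (at_left u))"

definition smooth_curve :: "(real \<Rightarrow> complex) \<Rightarrow> bool" where
  "smooth_curve x \<longleftrightarrow>
     (\<forall>n u. (((\<lambda>f w. vector_derivative f (at w)) ^^ n) x) differentiable (at u)) \<and>
     (\<forall>u. vector_derivative x (at u) \<noteq> 0)"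

section \<open>Self-similar solutions of the inverse mean curvature flow\<close>

text \<open>
  At a regular point the curvature has to be nonzero (in HOL \<open>1 / 0 = 0\<close>, so this must be
  said). At a singular point the curvature is infinite: \<open>x'\<close> vanishes but \<open>T'\<close> does not. This
  also prevents the curve from running back along the branch on which it came. The
  nonconstancy excludes only the point curve at the origin.
\<close>

definition self_similar_solution :: "real \<Rightarrow> real \<Rightarrow> (real \<Rightarrow> complex) \<Rightarrow> bool" where
  "self_similar_solution c d x \<longleftrightarrow>
     (\<exists>u w. x u \<noteq> x w) \<and>
     (\<exists>T. unit_tangent_along x T \<and>
        (\<forall>u. if vector_derivative x (at u) \<noteq> 0
             then signed_curvature x T u \<noteq> 0 \<and>
                  c * (x u \<bullet> T u) - d * (x u \<bullet> normal T u) = 1 / signed_curvature x T u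
             else vector_derivative T (at u) \<noteq> 0 \<and>
                  c * (x u \<bullet> T u) - d * (x u \<bullet> normal T u) = 0))"

text \<open>
  With \<open>N = i T\<close>, the equation \<open>c \<langle>x,T\<rangle> - d \<langle>x,N\<rangle> = 1/k\<close> says that \<open>exp ((d - c i) t) x\<close> has
  normal velocity \<open>-1/k\<close>, so a positive \<open>c\<close> is a clockwise rotation.
\<close>

lemma self_similar_normal_velocity:
  "((of_real d - of_real c * \<i>) * z) \<bullet> (\<i> * \<tau>) = - (c * (z \<bullet> \<tau>) - d * (z \<bullet> (\<i> * \<tau>)))"
  by (simp add: inner_complex_def algebra_simps)

definition regular_reparam :: "(real \<Rightarrow> real) \<Rightarrow> bool" where
  "regular_reparam \<phi> \<longleftrightarrow> (\<forall>u. \<phi> differentiable (at u) \<and> deriv \<phi> u \<noteq> 0)"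

definition maximal_solution :: "real \<Rightarrow> real \<Rightarrow> (real \<Rightarrow> complex) \<Rightarrow> bool" where
  "maximal_solution c d x \<longleftrightarrow> self_similar_solution c d x \<and>
     (\<forall>y \<phi>. self_similar_solution c d y \<and> regular_reparam \<phi> \<and> x = y \<circ> \<phi> \<longrightarrow> surj \<phi>)"

definition same_up_to_rot_scale :: "(real \<Rightarrow> complex) \<Rightarrow> (real \<Rightarrow> complex) \<Rightarrow> bool" where
  "same_up_to_rot_scale x y \<longleftrightarrow>
     (\<exists>r \<alpha> \<phi>. r > 0 \<and> regular_reparam \<phi> \<and> surj \<phi> \<and> y = (\<lambda>u. of_real r * cis \<alpha> * x (\<phi> u)))"

definition solutions_up_to_rot_scale :: "real \<Rightarrow> real \<Rightarrow> (real \<Rightarrow> complex) list \<Rightarrow> bool" where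
  "solutions_up_to_rot_scale c d xs \<longleftrightarrow>
     (\<forall>x \<in> set xs. maximal_solution c d x) \<and>
     (\<forall>i < length xs. \<forall>j < length xs. same_up_to_rot_scale (xs ! i) (xs ! j) \<longrightarrow> i = j) \<and>
     (\<forall>y. maximal_solution c d y \<longrightarrow> (\<exists>x \<in> set xs. same_up_to_rot_scale x y))"

definition tangent_angle_param :: "(real \<Rightarrow> complex) \<Rightarrow> bool" where
  "tangent_angle_param x \<longleftrightarrow> (\<exists>\<alpha>. unit_tangent_along x (\<lambda>\<theta>. cis (\<theta> + \<alpha>)))"

section \<open>Shape of the solutions\<close>

definition logarithmic_spiral :: "(real \<Rightarrow> complex) \<Rightarrow> bool" where
  "logarithmic_spiral y \<longleftrightarrow>
     (\<exists>a \<rho> \<omega>. a \<noteq> 0 \<and> \<rho> \<noteq> 0 \<and> \<omega> \<noteq> 0 \<and> y = (\<lambda>\<theta>. a * exp (Complex \<rho> \<omega> * of_real \<theta>)))"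

definition origin_circle :: "(real \<Rightarrow> complex) \<Rightarrow> bool" where
  "origin_circle y \<longleftrightarrow>
     (\<exists>a \<omega>. a \<noteq> 0 \<and> \<omega> \<noteq> 0 \<and> y = (\<lambda>\<theta>. a * exp (Complex 0 \<omega> * of_real \<theta>)))"

text \<open>
  A cycloid has its cusps equally spaced on a base line, and the motion of the base line by one
  step moves each arch to the next one. Here the base line is replaced by a spiral or circle \<open>b\<close>,
  and the translation by the similarity about the origin that moves \<open>b\<close> into itself by one step.
\<close>

definition cycloid_along :: "(real \<Rightarrow> complex) \<Rightarrow> (real \<Rightarrow> complex) \<Rightarrow> bool" where
  "cycloid_along x b \<longleftrightarrow>
     (\<exists>\<theta>\<^sub>0 p. p > 0 \<and>
        {\<theta>. cusp x \<theta>} = range (\<lambda>j::int. \<theta>\<^sub>0 + of_int j * p) \<and>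
        (\<forall>\<theta>. cusp x \<theta> \<longrightarrow> x \<theta> = b \<theta>) \<and>
        (\<forall>\<theta>. x (\<theta> + p) = b (\<theta> + p) / b \<theta> * x \<theta>))"

text \<open>Two notions of being asymptotic, both for curves that are parametrized by tangent angle and
  both up to rotation and scaling. In the first one a single similarity makes the ratio of the
  curves tend to one. In the second one both curves are rotated and scaled so that their current
  points become \<open>1\<close>, and then they approach each other locally uniformly. For \<open>y\<close> a spiral or
  circle the first notion implies the second.\<close>

definition asymptotic_ratio ::
  "real filter \<Rightarrow> (real \<Rightarrow> complex) \<Rightarrow> (real \<Rightarrow> complex) \<Rightarrow> bool" where
  "asymptotic_ratio F x y \<longleftrightarrow> (\<exists>a. a \<noteq> 0 \<and> x \<sim>[F] (\<lambda>\<theta>. a * y \<theta>))"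

definition asymptotic_shape ::
  "real filter \<Rightarrow> (real \<Rightarrow> complex) \<Rightarrow> (real \<Rightarrow> complex) \<Rightarrow> bool" where
  "asymptotic_shape F x y \<longleftrightarrow>
     (\<forall>R. uniform_limit {-R..R} (\<lambda>\<theta> h. x (\<theta> + h) / x \<theta> - y (\<theta> + h) / y \<theta>) (\<lambda>h. 0) F)"

end

theory Submission
  imports Defs "HOL-Real_Asymp.Real_Asymp"
begin

text \<open>
  Both clauses of the definition of a self-similar solution say that the tangent angle \<open>\<phi>\<close> has
  nonzero speed \<open>\<omega>\<close> and that the signed speed of the curve is \<open>\<omega> (c \<langle>x,T\<rangle> - d \<langle>x,N\<rangle>)\<close>. So the tangent
  angle is a regular parameter, and in this parameter the curve is a solution of a linear
  equation: the support function \<open>h = \<langle>x,N\<rangle>\<close> satisfies \<open>h' = - \<langle>x,T\<rangle>\<close> and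
  \<open>h'' = c h' - (1 - d) h\<close>. Conversely \<open>h\<close> gives back the curve as \<open>(-h' + i h) cis \<theta>\<close>, which is defined
  for all \<open>\<theta>\<close>. Therefore each solution is part of a support curve on the whole line
  (\<open>self_similar_solution_is_support_curve\<close>), and the maximal solutions are exactly the
  support curves on the whole line.

  A rotation of the curve is a translation of \<open>h\<close> and a scaling is a multiplication of \<open>h\<close>. By
  \<open>support_curve_rigidity\<close> there are no other coincidences, since a change of parameter that
  matches tangent directions must be a translation. So what has to be classified are the
  solutions \<open>h\<close> up to translation and factor (\<open>solutions_up_to_rot_scale_support_curves\<close>). The
  characteristic roots are \<open>c/2 \<plusminus> sqrt (c\<^sup>2/4 + d - 1)\<close>.

  For complex roots every \<open>h\<close> is a translate of a multiple of \<open>exp (c \<theta> / 2) cos (K \<theta>)\<close>: one class. For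
  a double root \<open>h = (A + B \<theta>) exp (c \<theta> / 2)\<close>, and a translation removes \<open>A\<close> unless \<open>B = 0\<close>: two
  classes. For real roots \<open>h = A exp (\<sigma> \<theta>) + B exp (\<tau> \<theta>)\<close>, a translation changes \<open>B / A\<close> by any positive
  factor, and only the vanishing of \<open>A\<close> or \<open>B\<close> or the sign of \<open>A B\<close> remains: four classes.

  The velocity is \<open>- (h'' + h) cis \<theta>\<close>, and the zeros of \<open>h'' + h\<close> are simple when \<open>(c, d) \<noteq> (0, 0)\<close>,
  so they are precisely the cusps (\<open>cusp_support_curve_iff\<close>) and can be read off from the
  explicit formulas, as can the asymptotics.
\<close>

section \<open>The equation of the support function\<close>

text \<open>Phrased with \<open>deriv\<close> instead of a second function argument, so that the support function alone
  determines the curve below.\<close>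

definition support_ode :: "real \<Rightarrow> real \<Rightarrow> (real \<Rightarrow> real) \<Rightarrow> bool" where
  "support_ode c d h \<longleftrightarrow>
     (\<forall>\<theta>. (h has_real_derivative deriv h \<theta>) (at \<theta>) \<and>
          (deriv h has_real_derivative c * deriv h \<theta> - (1 - d) * h \<theta>) (at \<theta>))"

lemma support_odeD:
  assumes "support_ode c d h"
  shows "(h has_real_derivative deriv h \<theta>) (at \<theta>)"
    and "(deriv h has_real_derivative c * deriv h \<theta> - (1 - d) * h \<theta>) (at \<theta>)"
  using assms by (auto simp: support_ode_def)

lemma support_odeI:
  assumes h: "\<And>\<theta>. (h has_real_derivative h' \<theta>) (at \<theta>)"
    and h': "\<And>\<theta>. (h' has_real_derivative c * h' \<theta> - (1 - d) * h \<theta>) (at \<theta>)"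
  shows "support_ode c d h" and "deriv h = h'"
proof -
  show *: "deriv h = h'"
    using h by (auto intro: DERIV_imp_deriv)
  show "support_ode c d h"
    unfolding support_ode_def * using h h' by blast
qed

lemma support_ode_lincomb:
  assumes f: "support_ode c d f" and g: "support_ode c d g"
  shows "support_ode c d (\<lambda>\<theta>. a * f \<theta> + b * g \<theta>)"
    and "deriv (\<lambda>\<theta>. a * f \<theta> + b * g \<theta>) = (\<lambda>\<theta>. a * deriv f \<theta> + b * deriv g \<theta>)"
proof -
  have 1: "((\<lambda>\<theta>. a * f \<theta> + b * g \<theta>) has_real_derivative a * deriv f \<theta> + b * deriv g \<theta>) (at \<theta>)" for \<theta>
    by (intro DERIV_add DERIV_cmult support_odeD(1)[OF f] support_odeD(1)[OF g])
  have "((\<lambda>\<theta>. a * deriv f \<theta> + b * deriv g \<theta>) has_real_derivative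
      a * (c * deriv f \<theta> - (1 - d) * f \<theta>) + b * (c * deriv g \<theta> - (1 - d) * g \<theta>)) (at \<theta>)" for \<theta>
    by (intro DERIV_add DERIV_cmult support_odeD(2)[OF f] support_odeD(2)[OF g])
  then have 2: "((\<lambda>\<theta>. a * deriv f \<theta> + b * deriv g \<theta>) has_real_derivative
      c * (a * deriv f \<theta> + b * deriv g \<theta>) - (1 - d) * (a * f \<theta> + b * g \<theta>)) (at \<theta>)" for \<theta>
    by (simp add: algebra_simps)
  show "support_ode c d (\<lambda>\<theta>. a * f \<theta> + b * g \<theta>)"
    "deriv (\<lambda>\<theta>. a * f \<theta> + b * g \<theta>) = (\<lambda>\<theta>. a * deriv f \<theta> + b * deriv g \<theta>)"
    using support_odeI[OF 1 2] by blast+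
qed

lemma support_ode_shift:
  assumes f: "support_ode c d f"
  shows "support_ode c d (\<lambda>\<theta>. f (\<theta> + k))"
    and "deriv (\<lambda>\<theta>. f (\<theta> + k)) = (\<lambda>\<theta>. deriv f (\<theta> + k))"
proof -
  have 1: "((\<lambda>\<theta>. f (\<theta> + k)) has_real_derivative deriv f (\<theta> + k)) (at \<theta>)" for \<theta>
    using support_odeD(1)[OF f, of "\<theta> + k"] by (simp add: DERIV_shift)
  have 2: "((\<lambda>\<theta>. deriv f (\<theta> + k)) has_real_derivative
      c * deriv f (\<theta> + k) - (1 - d) * f (\<theta> + k)) (at \<theta>)" for \<theta>
    using support_odeD(2)[OF f, of "\<theta> + k"] by (simp add: DERIV_shift)
  show "support_ode c d (\<lambda>\<theta>. f (\<theta> + k))"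
    "deriv (\<lambda>\<theta>. f (\<theta> + k)) = (\<lambda>\<theta>. deriv f (\<theta> + k))"
    using support_odeI[OF 1 2] by blast+
qed

text \<open>The factor \<open>exp (c \<theta> / 2)\<close> completes the square in the characteristic polynomial: what
  remains is \<open>y'' = \<kappa> y\<close> with \<open>\<kappa> = c\<^sup>2/4 + d - 1\<close>. Its solutions \<open>C\<close> and \<open>S\<close> are the trigonometric,
  polynomial or hyperbolic cosine and sine, so that the three signs of \<open>\<kappa>\<close> are treated together.\<close>

lemma support_ode_exp_times:
  fixes C S :: "real \<Rightarrow> real"
  assumes S: "\<And>\<theta>. (S has_real_derivative C \<theta>) (at \<theta>)"
    and C: "\<And>\<theta>. (C has_real_derivative (c\<^sup>2 / 4 + d - 1) * S \<theta>) (at \<theta>)"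
    and s_def: "s = (\<lambda>\<theta>. exp (c / 2 * \<theta>) * S \<theta>)" and k_def: "k = (\<lambda>\<theta>. exp (c / 2 * \<theta>) * C \<theta>)"
  shows "support_ode c d s" and "deriv s = (\<lambda>\<theta>. c / 2 * s \<theta> + k \<theta>)"
    and "support_ode c d k" and "deriv k = (\<lambda>\<theta>. c / 2 * k \<theta> + (c\<^sup>2 / 4 + d - 1) * s \<theta>)"
proof -
  have s: "(s has_real_derivative c / 2 * s \<theta> + k \<theta>) (at \<theta>)" for \<theta>
    unfolding s_def k_def
    by (rule derivative_eq_intros S refl)+ (simp add: algebra_simps)
  have k: "(k has_real_derivative c / 2 * k \<theta> + (c\<^sup>2 / 4 + d - 1) * s \<theta>) (at \<theta>)" for \<theta>
    unfolding s_def k_def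
    by (rule derivative_eq_intros C refl)+ (simp add: algebra_simps)
  have s': "((\<lambda>\<theta>. c / 2 * s \<theta> + k \<theta>) has_real_derivative
      c * (c / 2 * s \<theta> + k \<theta>) - (1 - d) * s \<theta>) (at \<theta>)" for \<theta>
    by (rule derivative_eq_intros s k refl)+ (simp add: algebra_simps power2_eq_square)
  have k': "((\<lambda>\<theta>. c / 2 * k \<theta> + (c\<^sup>2 / 4 + d - 1) * s \<theta>) has_real_derivative
      c * (c / 2 * k \<theta> + (c\<^sup>2 / 4 + d - 1) * s \<theta>) - (1 - d) * k \<theta>) (at \<theta>)" for \<theta>
    by (rule derivative_eq_intros s k refl)+ (simp add: algebra_simps power2_eq_square)
  show "support_ode c d s" "deriv s = (\<lambda>\<theta>. c / 2 * s \<theta> + k \<theta>)"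
    using support_odeI[OF s s'] by blast+
  show "support_ode c d k" "deriv k = (\<lambda>\<theta>. c / 2 * k \<theta> + (c\<^sup>2 / 4 + d - 1) * s \<theta>)"
    using support_odeI[OF k k'] by blast+
qed

lemma cosine_sine_pair:
  obtains C S :: "real \<Rightarrow> real"
  where "\<And>\<theta>. (S has_real_derivative C \<theta>) (at \<theta>)"
    and "\<And>\<theta>. (C has_real_derivative \<kappa> * S \<theta>) (at \<theta>)"
    and "C 0 = 1" and "S 0 = 0"
proof (cases \<kappa> "0::real" rule: linorder_cases)
  case less
  define K where "K = sqrt (- \<kappa>)"
  have K: "K > 0" "- (K * K) = \<kappa>" using less by (auto simp: K_def)
  show ?thesis
    by (rule that[of "\<lambda>\<theta>. sin (K * \<theta>) / K" "\<lambda>\<theta>. cos (K * \<theta>)"])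
      (use K in \<open>auto intro!: derivative_eq_intros simp flip: K(2)\<close>)
next
  case equal
  show ?thesis
    by (rule that[of "\<lambda>\<theta>. \<theta>" "\<lambda>\<theta>. 1"]) (use equal in \<open>auto intro!: derivative_eq_intros\<close>)
next
  case greater
  define K where "K = sqrt \<kappa>"
  have K: "K > 0" "K * K = \<kappa>" using greater by (auto simp: K_def)
  show ?thesis
    by (rule that[of "\<lambda>\<theta>. sinh (K * \<theta>) / K" "\<lambda>\<theta>. cosh (K * \<theta>)"])
      (use K in \<open>auto intro!: derivative_eq_intros simp flip: K(2)\<close>)
qed

lemma support_ode_initial_value:
  obtains h where "support_ode c d h" "h t = a" "deriv h t = b"
proof -
  obtain C S where CS: "\<And>\<theta>. (S has_real_derivative C \<theta>) (at \<theta>)"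
    "\<And>\<theta>. (C has_real_derivative (c\<^sup>2 / 4 + d - 1) * S \<theta>) (at \<theta>)"
    and 0: "C 0 = 1" "S 0 = 0"
    using cosine_sine_pair[where \<kappa> = "c\<^sup>2 / 4 + d - 1"] by metis
  define s k where "s = (\<lambda>\<theta>. exp (c / 2 * \<theta>) * S \<theta>)" and "k = (\<lambda>\<theta>. exp (c / 2 * \<theta>) * C \<theta>)"
  note e = support_ode_exp_times[OF CS s_def k_def]
  have 0: "s 0 = 0" "k 0 = 1"
    by (simp_all add: s_def k_def 0)
  define g where "g = (\<lambda>\<theta>. a * k \<theta> + (b - c / 2 * a) * s \<theta>)"
  have g: "support_ode c d g" "g 0 = a" "deriv g 0 = b"
    unfolding g_def support_ode_lincomb(2)[OF e(3) e(1)]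
    by (rule support_ode_lincomb(1)[OF e(3) e(1)]) (simp_all add: e 0)
  show ?thesis
    using that[of "\<lambda>\<theta>. g (\<theta> + - t)"] support_ode_shift[OF g(1), of "- t"] g by simp
qed

text \<open>For a curve \<open>x\<close> whose unit tangent has the angle \<open>\<phi>\<close>, the functions \<open>p = \<langle>x,T\<rangle>\<close> and
  \<open>q = \<langle>x,N\<rangle>\<close> satisfy the hypotheses below. The conserved quantity is the Wronskian of \<open>q\<close> and
  \<open>g \<circ> \<phi>\<close>, divided by its Abel factor. Its derivative vanishes identically, so uniqueness follows although \<open>\<omega> = \<phi>'\<close> may be discontinuous.\<close>

lemma wronskian_along_constant:
  fixes p q \<phi> \<omega> :: "real \<Rightarrow> real"
  assumes g: "support_ode c d g"
    and \<phi>: "\<And>u. (\<phi> has_real_derivative \<omega> u) (at u)"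
    and p: "\<And>u. (p has_real_derivative \<omega> u * (c * p u + (1 - d) * q u)) (at u)"
    and q: "\<And>u. (q has_real_derivative - (\<omega> u * p u)) (at u)"
  shows "exp (- c * \<phi> u) * (q u * deriv g (\<phi> u) + p u * g (\<phi> u)) =
         exp (- c * \<phi> w) * (q w * deriv g (\<phi> w) + p w * g (\<phi> w))"
proof -
  have g\<phi>: "((\<lambda>u. g (\<phi> u)) has_real_derivative deriv g (\<phi> u) * \<omega> u) (at u)"
    and g'\<phi>: "((\<lambda>u. deriv g (\<phi> u)) has_real_derivative
        (c * deriv g (\<phi> u) - (1 - d) * g (\<phi> u)) * \<omega> u) (at u)" for u
    using DERIV_chain2[OF support_odeD(1)[OF g] \<phi>] DERIV_chain2[OF support_odeD(2)[OF g] \<phi>] .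
  have "((\<lambda>u. exp (- c * \<phi> u) * (q u * deriv g (\<phi> u) + p u * g (\<phi> u)))
          has_real_derivative 0) (at u)" for u
    by (rule derivative_eq_intros \<phi> p q g\<phi> g'\<phi> refl)+ (simp add: algebra_simps)
  then show ?thesis
    using DERIV_isconst_all[of "\<lambda>u. exp (- c * \<phi> u) * (q u * deriv g (\<phi> u) + p u * g (\<phi> u))" u w]
    by blast
qed

text \<open>Solutions \<open>g\<close> with arbitrary values of \<open>g\<close> and \<open>g'\<close> at the point \<open>\<phi> u\<close> exist, so the
  vanishing of all the conserved quantities gives \<open>p u = q u = 0\<close>.\<close>

lemma uniqueness_along:
  fixes p q \<phi> \<omega> :: "real \<Rightarrow> real"
  assumes \<phi>: "\<And>u. (\<phi> has_real_derivative \<omega> u) (at u)"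
    and p: "\<And>u. (p has_real_derivative \<omega> u * (c * p u + (1 - d) * q u)) (at u)"
    and q: "\<And>u. (q has_real_derivative - (\<omega> u * p u)) (at u)"
    and 0: "p w = 0" "q w = 0"
  shows "p u = 0" "q u = 0"
proof -
  have *: "q u * deriv g (\<phi> u) + p u * g (\<phi> u) = 0" if "support_ode c d g" for g
    using wronskian_along_constant[OF that \<phi> p q, of u w] 0 by simp
  obtain g1 where "support_ode c d g1" "g1 (\<phi> u) = 1" "deriv g1 (\<phi> u) = 0"
    by (rule support_ode_initial_value)
  with * show "p u = 0" by fastforce
  obtain g2 where "support_ode c d g2" "g2 (\<phi> u) = 0" "deriv g2 (\<phi> u) = 1"
    by (rule support_ode_initial_value)
  with * show "q u = 0" by fastforce
qed

lemma support_ode_zero: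
  assumes h: "support_ode c d h" and "h t = 0" "deriv h t = 0"
  shows "h \<theta> = 0"
proof (rule uniqueness_along(2)[where \<phi> = "\<lambda>u. u" and \<omega> = "\<lambda>_. 1" and p = "\<lambda>u. - deriv h u"
        and q = h and w = t and c = c and d = d])
  show "((\<lambda>u. - deriv h u) has_real_derivative 1 * (c * - deriv h u + (1 - d) * h u)) (at u)" for u
    by (rule derivative_eq_intros support_odeD[OF h] refl)+ (simp add: algebra_simps)
qed (use assms support_odeD(1)[OF h] in auto)

lemma support_ode_unique:
  assumes f: "support_ode c d f" and g: "support_ode c d g"
    and "f t = g t" "deriv f t = deriv g t"
  shows "f = g"
proof
  fix \<theta>
  have "1 * f \<theta> + (- 1) * g \<theta> = 0"
  proof (rule support_ode_zero[where h = "\<lambda>\<theta>. 1 * f \<theta> + (- 1) * g \<theta>"])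
    show "support_ode c d (\<lambda>\<theta>. 1 * f \<theta> + (- 1) * g \<theta>)"
      by (rule support_ode_lincomb(1)[OF f g])
    show "deriv (\<lambda>\<theta>. 1 * f \<theta> + (- 1) * g \<theta>) t = 0"
      unfolding support_ode_lincomb(2)[OF f g] using assms by simp
  qed (use assms in simp)
  then show "f \<theta> = g \<theta>"
    by simp
qed

lemma support_ode_general_solution:
  fixes C S :: "real \<Rightarrow> real"
  assumes S: "\<And>\<theta>. (S has_real_derivative C \<theta>) (at \<theta>)"
    and C: "\<And>\<theta>. (C has_real_derivative (c\<^sup>2 / 4 + d - 1) * S \<theta>) (at \<theta>)"
    and 0: "C 0 = 1" "S 0 = 0" and h: "support_ode c d h"
  obtains a b where "\<And>\<theta>. h \<theta> = exp (c / 2 * \<theta>) * (a * C \<theta> + b * S \<theta>)"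
proof -
  define s k where "s = (\<lambda>\<theta>. exp (c / 2 * \<theta>) * S \<theta>)" and "k = (\<lambda>\<theta>. exp (c / 2 * \<theta>) * C \<theta>)"
  note e = support_ode_exp_times[OF S C s_def k_def]
  have 0: "s 0 = 0" "k 0 = 1"
    by (simp_all add: s_def k_def 0)
  let ?a = "h 0" and ?b = "deriv h 0 - c / 2 * h 0"
  have "h = (\<lambda>\<theta>. ?a * k \<theta> + ?b * s \<theta>)"
    by (rule support_ode_unique[OF h support_ode_lincomb(1)[OF e(3) e(1)], of 0])
      (simp_all add: support_ode_lincomb(2)[OF e(3) e(1)] e 0)
  then have "h \<theta> = exp (c / 2 * \<theta>) * (?a * C \<theta> + ?b * S \<theta>)" for \<theta>
    by (simp add: s_def k_def algebra_simps fun_eq_iff)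
  with that show ?thesis .
qed

text \<open>The function \<open>h'' + h\<close>, rewritten by the equation of \<open>h\<close>. For a curve with support function
  \<open>h\<close> it is the radius of curvature up to sign.\<close>

definition curvature_radius :: "real \<Rightarrow> real \<Rightarrow> (real \<Rightarrow> real) \<Rightarrow> real \<Rightarrow> real" where
  "curvature_radius c d h \<theta> = c * deriv h \<theta> + d * h \<theta>"

lemma curvature_radius_deriv:
  assumes "support_ode c d h"
  shows "(curvature_radius c d h has_real_derivative
           (c\<^sup>2 + d) * deriv h \<theta> - c * (1 - d) * h \<theta>) (at \<theta>)"
  unfolding curvature_radius_def
  by (rule derivative_eq_intros support_odeD[OF assms] refl)+
    (simp add: algebra_simps power2_eq_square)

text \<open>The radius of curvature and its derivative are linear forms in \<open>(h', h)\<close>, and the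
  determinant of the two forms is \<open>-(c\<^sup>2 + d\<^sup>2)\<close>. This is where \<open>(c, d) \<noteq> (0, 0)\<close> enters.\<close>

lemma curvature_radius_simple_zeros:
  assumes cd: "(c, d) \<noteq> (0, 0)" and h: "support_ode c d h" and nz: "h \<theta>\<^sub>0 \<noteq> 0"
    and 0: "curvature_radius c d h \<theta> = 0"
  shows "(c\<^sup>2 + d) * deriv h \<theta> - c * (1 - d) * h \<theta> \<noteq> 0"
proof
  assume 1: "(c\<^sup>2 + d) * deriv h \<theta> - c * (1 - d) * h \<theta> = 0"
  have "(c\<^sup>2 + d\<^sup>2) * deriv h \<theta> = 0" "(c\<^sup>2 + d\<^sup>2) * h \<theta> = 0"
    using 0 1 unfolding curvature_radius_def by algebra+
  moreover have "c\<^sup>2 + d\<^sup>2 \<noteq> 0"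
    using cd by (simp add: sum_power2_eq_zero_iff)
  ultimately have "deriv h \<theta> = 0" "h \<theta> = 0"
    by (simp_all only: mult_eq_0_iff) auto
  then show False
    using support_ode_zero[OF h, of \<theta> \<theta>\<^sub>0] nz by simp
qed

lemma eventually_sgn_at_simple_zero:
  fixes f :: "real \<Rightarrow> real"
  assumes f: "(f has_real_derivative D) (at u)" and 0: "f u = 0" and D: "D \<noteq> 0"
  shows "\<forall>\<^sub>F w in at u. sgn (f w) = sgn D * sgn (w - u)"
proof -
  have "((\<lambda>w. f w / (w - u)) \<longlongrightarrow> D) (at u)"
    using f 0 by (simp add: has_field_derivative_iff)
  then have "((\<lambda>w. sgn (f w / (w - u))) \<longlongrightarrow> sgn D) (at u)"
    using D by (rule tendsto_sgn)
  then have "\<forall>\<^sub>F w in at u. dist (sgn (f w / (w - u))) (sgn D) < 1"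
    by (rule tendstoD) simp
  then have "\<forall>\<^sub>F w in at u. w \<noteq> u \<and> dist (sgn (f w / (w - u))) (sgn D) < 1"
    by (simp add: eventually_at_filter)
  then show ?thesis
    by eventually_elim (use D in \<open>auto simp: sgn_real_def dist_real_def zero_less_divide_iff
        divide_less_0_iff split: if_splits\<close>)
qed

section \<open>Curves with a given support function\<close>

text \<open>The curve whose tangent line at the point with tangent direction \<open>cis \<theta>\<close> has signed distance
  \<open>h \<theta>\<close> from the origin: in the frame \<open>(T, N)\<close> its position has the coordinates \<open>(-h', h)\<close>.\<close>

definition support_curve :: "(real \<Rightarrow> real) \<Rightarrow> real \<Rightarrow> complex" where
  "support_curve h \<theta> = Complex (- deriv h \<theta>) (h \<theta>) * cis \<theta>"

lemma has_vector_derivative_cis_comp: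
  assumes "(\<phi> has_real_derivative \<omega>) (at u)"
  shows "((\<lambda>u. cis (\<phi> u)) has_vector_derivative \<omega> *\<^sub>R (\<i> * cis (\<phi> u))) (at u)"
proof -
  have "(cis has_vector_derivative \<i> * cis t) (at t)" for t
    using has_derivative_cis[OF has_derivative_ident, of t UNIV]
    by (simp add: has_vector_derivative_def)
  then show ?thesis
    using vector_diff_chain_at[of \<phi> \<omega> u cis "\<i> * cis (\<phi> u)"] assms
    by (simp add: o_def has_real_derivative_iff_has_vector_derivative)
qed

lemma support_curve_has_vector_derivative:
  assumes h: "support_ode c d h"
  shows "((\<lambda>\<theta>. m * support_curve h \<theta>) has_vector_derivative
           - curvature_radius c d h \<theta> *\<^sub>R (m * cis \<theta>)) (at \<theta>)"
proof -
  note h' = support_odeD[OF h, of \<theta>, unfolded has_real_derivative_iff_has_vector_derivative]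
  note d = h'[THEN bounded_linear.has_vector_derivative[OF bounded_linear_of_real[where 'a = complex]]]
  have "(cis has_vector_derivative 1 *\<^sub>R (\<i> * cis \<theta>)) (at \<theta>)"
    by (rule has_vector_derivative_cis_comp) (auto intro!: derivative_eq_intros)
  note derivs = this d
  have eq: "support_curve h = (\<lambda>\<theta>. (- of_real (deriv h \<theta>) + \<i> * of_real (h \<theta>)) * cis \<theta>)"
    by (simp add: fun_eq_iff support_curve_def complex_eq_iff)
  show ?thesis
    unfolding eq
    by (rule derivative_eq_intros derivs refl)+
      (simp add: curvature_radius_def complex_eq_iff algebra_simps)
qed

lemma inner_unit_frame:
  assumes "norm \<tau> = 1"
  shows "(z * \<tau>) \<bullet> \<tau> = Re z" "(z * \<tau>) \<bullet> (\<i> * \<tau>) = Im z"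
proof -
  have "(Re \<tau>)\<^sup>2 + (Im \<tau>)\<^sup>2 = 1"
    using assms cmod_power2[of \<tau>] by simp
  then show "(z * \<tau>) \<bullet> \<tau> = Re z" "(z * \<tau>) \<bullet> (\<i> * \<tau>) = Im z"
    unfolding inner_complex_def by (simp; algebra)+
qed

text \<open>The two clauses in the definition of self-similar solutions are one: with signed speed \<open>v\<close>
  and angular speed \<open>\<omega>\<close> of the tangent, \<open>1/k = v/\<omega>\<close>, and both clauses force \<open>\<omega> \<noteq> 0\<close>.\<close>

lemma self_similar_clause_iff:
  assumes x: "vector_derivative x (at u) = v *\<^sub>R T u"
    and T: "vector_derivative T (at u) = \<omega> *\<^sub>R (\<i> * T u)" and n: "norm (T u) = 1"
  shows "(if vector_derivative x (at u) \<noteq> 0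
             then signed_curvature x T u \<noteq> 0 \<and>
                  c * (x u \<bullet> T u) - d * (x u \<bullet> normal T u) = 1 / signed_curvature x T u
             else vector_derivative T (at u) \<noteq> 0 \<and>
                  c * (x u \<bullet> T u) - d * (x u \<bullet> normal T u) = 0) \<longleftrightarrow>
         \<omega> \<noteq> 0 \<and> v = \<omega> * (c * (x u \<bullet> T u) - d * (x u \<bullet> normal T u))"
proof -
  have "T u \<noteq> 0" using n by auto
  moreover have "signed_curvature x T u = \<omega> / v"
    using inner_unit_frame[OF n, of 1] inner_unit_frame[OF n, of \<i>]
    by (simp add: signed_curvature_def x T normal_def)
  ultimately show ?thesis
    by (auto simp: x T field_simps)
qed

lemma support_curve_unit_tangent_along:
  assumes h: "support_ode c d h" and m: "m \<noteq> 0"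
  shows "unit_tangent_along (\<lambda>\<theta>. m * support_curve h \<theta>) (\<lambda>\<theta>. sgn m * cis \<theta>)"
  unfolding unit_tangent_along_def
proof (intro allI conjI)
  fix \<theta>
  note x' = support_curve_has_vector_derivative[OF h, of m \<theta>]
  show "(\<lambda>\<theta>. m * support_curve h \<theta>) differentiable (at \<theta>)"
    by (rule differentiableI_vector[OF x'])
  have "((\<lambda>\<theta>. sgn m * cis \<theta>) has_vector_derivative sgn m * (1 *\<^sub>R (\<i> * cis \<theta>))) (at \<theta>)"
    by (intro has_vector_derivative_mult_right has_vector_derivative_cis_comp) auto
  then show "(\<lambda>\<theta>. sgn m * cis \<theta>) differentiable (at \<theta>)"
    by (rule differentiableI_vector)
  show "norm (sgn m * cis \<theta>) = 1"
    using m by (simp add: norm_mult norm_sgn)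
  have "vector_derivative (\<lambda>\<theta>. m * support_curve h \<theta>) (at \<theta>) =
      (- curvature_radius c d h \<theta> * norm m) *\<^sub>R (sgn m * cis \<theta>)"
    using x' m by (simp add: vector_derivative_at sgn_eq scaleR_conv_of_real)
  then show "\<exists>v. vector_derivative (\<lambda>\<theta>. m * support_curve h \<theta>) (at \<theta>) = v *\<^sub>R (sgn m * cis \<theta>)"
    by blast
qed

lemma support_curve_tangent_angle_param:
  assumes "support_ode c d h" and "m \<noteq> 0"
  shows "tangent_angle_param (\<lambda>\<theta>. m * support_curve h \<theta>)"
  using support_curve_unit_tangent_along[OF assms] cis_Arg[OF assms(2)]
  unfolding tangent_angle_param_def by (metis (no_types, lifting) cis_mult ext mult.commute)

lemma curvature_radius_not_identically_zero:
  assumes cd: "(c, d) \<noteq> (0, 0)" and h: "support_ode c d h" and nz: "h \<theta>\<^sub>0 \<noteq> 0"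
  obtains \<theta> where "curvature_radius c d h \<theta> \<noteq> 0"
proof (rule ccontr)
  assume "\<not> thesis"
  then have 0: "curvature_radius c d h = (\<lambda>_. 0)"
    using that by blast
  have "((\<lambda>_. 0) has_real_derivative (c\<^sup>2 + d) * deriv h 0 - c * (1 - d) * h 0) (at 0)"
    using curvature_radius_deriv[OF h, of 0] by (simp add: 0)
  then have "(c\<^sup>2 + d) * deriv h 0 - c * (1 - d) * h 0 = 0"
    using DERIV_const DERIV_unique by blast
  then show False
    using curvature_radius_simple_zeros[OF cd h nz, of 0] 0 by simp
qed

lemma support_curve_self_similar:
  assumes cd: "(c, d) \<noteq> (0, 0)" and h: "support_ode c d h" and nz: "h \<theta>\<^sub>0 \<noteq> 0" and m: "m \<noteq> 0"
  shows "self_similar_solution c d (\<lambda>\<theta>. m * support_curve h \<theta>)"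
    (is "self_similar_solution c d ?x")
  unfolding self_similar_solution_def
proof (intro conjI exI[of _ "\<lambda>\<theta>. sgn m * cis \<theta>"] allI)
  note x' = support_curve_has_vector_derivative[OF h, of m]
  show "\<exists>u w. ?x u \<noteq> ?x w"
  proof (rule ccontr)
    assume "\<not> ?thesis"
    then have c: "?x = (\<lambda>_. ?x 0)" by blast
    obtain \<theta> where \<theta>: "curvature_radius c d h \<theta> \<noteq> 0"
      by (rule curvature_radius_not_identically_zero[OF cd h nz])
    have "- curvature_radius c d h \<theta> *\<^sub>R (m * cis \<theta>) = 0"
      using x'[of \<theta>] c has_vector_derivative_const vector_derivative_unique_at by metis
    with \<theta> m show False by simp
  qed
  show "unit_tangent_along ?x (\<lambda>\<theta>. sgn m * cis \<theta>)"
    by (rule support_curve_unit_tangent_along[OF h m])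
  fix u
  let ?T = "\<lambda>\<theta>. sgn m * cis \<theta>"
  have n: "norm (?T u) = 1"
    using m by (simp add: norm_mult norm_sgn)
  have T: "vector_derivative ?T (at u) = 1 *\<^sub>R (\<i> * ?T u)"
    using has_vector_derivative_mult_right[OF has_vector_derivative_cis_comp[of "\<lambda>u. u" 1 u], of "sgn m"]
    by (simp add: vector_derivative_at mult.left_commute)
  have v: "vector_derivative ?x (at u) = (- curvature_radius c d h u * norm m) *\<^sub>R ?T u"
    using x'[of u] m by (simp add: vector_derivative_at sgn_eq scaleR_conv_of_real)
  have "?x u = (norm m * Complex (- deriv h u) (h u)) * ?T u"
    using m by (simp add: support_curve_def sgn_eq)
  then have "?x u \<bullet> ?T u = - norm m * deriv h u" "?x u \<bullet> normal ?T u = norm m * h u"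
    using inner_unit_frame[OF n, of "norm m * Complex (- deriv h u) (h u)"]
    by (simp_all add: normal_def)
  then show "if vector_derivative ?x (at u) \<noteq> 0
             then signed_curvature ?x ?T u \<noteq> 0 \<and>
                  c * (?x u \<bullet> ?T u) - d * (?x u \<bullet> normal ?T u) = 1 / signed_curvature ?x ?T u
             else vector_derivative ?T (at u) \<noteq> 0 \<and>
                  c * (?x u \<bullet> ?T u) - d * (?x u \<bullet> normal ?T u) = 0"
    unfolding self_similar_clause_iff[OF v T n]
    by (simp add: curvature_radius_def algebra_simps)
qed

text \<open>The direction of the velocity is \<open>cis \<theta>\<close> up to a constant and the sign of the radius of
  curvature. It is continuous where the radius is nonzero, and it jumps to its opposite at a zero
  because the zero is simple.\<close>

lemma cusp_support_curve_iff:
  assumes cd: "(c, d) \<noteq> (0, 0)" and h: "support_ode c d h" and nz: "h \<theta>\<^sub>0 \<noteq> 0" and m: "m \<noteq> 0"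
  shows "cusp (\<lambda>\<theta>. m * support_curve h \<theta>) u \<longleftrightarrow> curvature_radius c d h u = 0"
proof -
  let ?\<rho> = "curvature_radius c d h"
  let ?s = "\<lambda>w. sgn (vector_derivative (\<lambda>\<theta>. m * support_curve h \<theta>) (at w))"
  have s: "?s = (\<lambda>w. - (sgn (?\<rho> w) *\<^sub>R (sgn m * cis w)))"
    by (simp add: vector_derivative_at[OF support_curve_has_vector_derivative[OF h, of m]]
        fun_eq_iff sgn_mult sgn_scaleR sgn_minus)
  have unit: "((\<lambda>w. sgn m * cis w) \<longlongrightarrow> sgn m * cis u) (at u within A)" for A
    by (intro tendsto_intros)
  have \<rho>: "(?\<rho> \<longlongrightarrow> ?\<rho> u) (at u within A)" for A
    using DERIV_isCont[OF curvature_radius_deriv[OF h]] continuous_at_imp_continuous_at_within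
    unfolding continuous_within by blast
  show ?thesis
  proof
    assume "cusp (\<lambda>\<theta>. m * support_curve h \<theta>) u"
    then obtain \<tau> where \<tau>: "norm \<tau> = 1" "(?s \<longlongrightarrow> \<tau>) (at_right u)" "(?s \<longlongrightarrow> - \<tau>) (at_left u)"
      unfolding cusp_def by blast
    show "?\<rho> u = 0"
    proof (rule ccontr)
      assume "?\<rho> u \<noteq> 0"
      then have "(?s \<longlongrightarrow> - (sgn (?\<rho> u) *\<^sub>R (sgn m * cis u))) (at u within A)" for A
        unfolding s by (intro tendsto_minus tendsto_scaleR tendsto_sgn \<rho> unit)
      then have "\<tau> = - (sgn (?\<rho> u) *\<^sub>R (sgn m * cis u))" "- \<tau> = - (sgn (?\<rho> u) *\<^sub>R (sgn m * cis u))"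
        using \<tau>(2,3) tendsto_unique trivial_limit_at_right_real trivial_limit_at_left_real by blast+
      then have "\<tau> = - \<tau>" by simp
      with \<tau>(1) show False by simp
    qed
  next
    assume 0: "?\<rho> u = 0"
    define D where "D = (c\<^sup>2 + d) * deriv h u - c * (1 - d) * h u"
    have "D \<noteq> 0"
      unfolding D_def by (rule curvature_radius_simple_zeros[OF cd h nz 0])
    then have ev: "\<forall>\<^sub>F w in at u. sgn (?\<rho> w) = sgn D * sgn (w - u)"
      using eventually_sgn_at_simple_zero[OF curvature_radius_deriv[OF h] 0] by (simp add: D_def)
    define \<tau> where "\<tau> = - (sgn D *\<^sub>R (sgn m * cis u))"
    have lim: "(?s \<longlongrightarrow> - (a *\<^sub>R (sgn m * cis u))) (at u within A)"
      if "\<forall>\<^sub>F w in at u within A. sgn (?\<rho> w) = a" for a A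
    proof (rule Lim_transform_eventually)
      show "((\<lambda>w. - (a *\<^sub>R (sgn m * cis w))) \<longlongrightarrow> - (a *\<^sub>R (sgn m * cis u))) (at u within A)"
        by (intro tendsto_intros)
      show "\<forall>\<^sub>F w in at u within A. - (a *\<^sub>R (sgn m * cis w)) = ?s w"
        using that by eventually_elim (simp only: fun_cong[OF s])
    qed
    have "\<forall>\<^sub>F w in at_right u. sgn (?\<rho> w) = sgn D"
      using ev unfolding eventually_at_filter by eventually_elim auto
    then have "(?s \<longlongrightarrow> \<tau>) (at_right u)"
      unfolding \<tau>_def by (rule lim)
    moreover have "\<forall>\<^sub>F w in at_left u. sgn (?\<rho> w) = - sgn D"
      using ev unfolding eventually_at_filter by eventually_elim auto
    then have "(?s \<longlongrightarrow> - \<tau>) (at_left u)"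
      using lim unfolding \<tau>_def by fastforce
    moreover have "norm \<tau> = 1"
      using \<open>D \<noteq> 0\<close> m by (simp add: \<tau>_def norm_mult norm_sgn)
    ultimately show "cusp (\<lambda>\<theta>. m * support_curve h \<theta>) u"
      unfolding cusp_def by blast
  qed
qed

section \<open>Every self-similar solution is a support curve\<close>

text \<open>A continuous logarithm exists because the line is contractible. Near \<open>u\<close> the angle differs from
  \<open>\<phi> u\<close> by less than \<open>\<pi>\<close>, hence it is given there by the principal logarithm of \<open>T w / T u\<close>, and this
  makes it differentiable.\<close>

lemma differentiable_angle_function:
  fixes T :: "real \<Rightarrow> complex"
  assumes T: "\<And>u. T differentiable (at u)" and n: "\<And>u. norm (T u) = 1"
  obtains \<phi> where "\<And>u. \<phi> differentiable (at u)" and "\<And>u. T u = cis (\<phi> u)"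
proof -
  have "continuous_on UNIV T"
    using T by (simp add: differentiable_imp_continuous_within continuous_at_imp_continuous_on)
  moreover have "T u \<noteq> 0" for u
    using n[of u] by auto
  ultimately obtain g where g: "continuous_on UNIV g" "\<And>u. T u = exp (g u)"
    using continuous_logarithm_on_contractible[of UNIV T] convex_imp_contractible[of "UNIV :: real set"]
    by auto
  define \<phi> where "\<phi> u = Im (g u)" for u
  have T\<phi>: "T u = cis (\<phi> u)" for u
    using n[of u] g(2)[of u] by (simp add: \<phi>_def exp_eq_polar norm_mult)
  have "isCont \<phi> u" for u
    unfolding \<phi>_def using g(1) by (simp add: continuous_on_eq_continuous_at isCont_Im)
  have "\<phi> differentiable (at u)" for u
  proof -
    let ?L = "\<lambda>w. \<phi> u + Im (Ln (T w * cnj (T u)))"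
    obtain D where "(T has_vector_derivative D) (at u)"
      using T vector_derivative_works by blast
    then have "((\<lambda>w. T w * cnj (T u)) has_vector_derivative D * cnj (T u)) (at u)"
      by (rule has_vector_derivative_mult_left)
    moreover have one: "T u * cnj (T u) = 1"
      using complex_norm_square[of "T u"] n[of u] by simp
    have "(Ln has_field_derivative inverse 1) (at (T u * cnj (T u)))"
      unfolding one by (rule has_field_derivative_Ln) simp
    ultimately have "((\<lambda>w. Ln (T w * cnj (T u))) has_vector_derivative D * cnj (T u)) (at u)"
      using field_vector_diff_chain_at by (fastforce simp: o_def)
    then have "((\<lambda>w. Im (Ln (T w * cnj (T u)))) has_vector_derivative Im (D * cnj (T u))) (at u)"
      by (rule bounded_linear.has_vector_derivative[OF bounded_linear_Im])
    then have L: "(?L has_real_derivative Im (D * cnj (T u))) (at u)"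
      unfolding has_real_derivative_iff_has_vector_derivative
      by (intro derivative_eq_intros) auto
    have "\<forall>\<^sub>F w in nhds u. dist (\<phi> w) (\<phi> u) < pi"
      using \<open>isCont \<phi> u\<close> unfolding isCont_def tendsto_iff eventually_at_filter
      by (auto elim!: eventually_mono dest!: spec[of _ pi])
    then have "\<forall>\<^sub>F w in nhds u. \<phi> w = ?L w"
    proof eventually_elim
      case (elim w)
      have "T w * cnj (T u) = exp (\<i> * of_real (\<phi> w - \<phi> u))"
        by (simp only: T\<phi> cis_cnj cis_mult diff_conv_add_uminus flip: cis_conv_exp)
      moreover have "Ln (exp (\<i> * of_real (\<phi> w - \<phi> u))) = \<i> * of_real (\<phi> w - \<phi> u)"
        using elim by (intro Ln_exp) (auto simp: dist_real_def)
      ultimately show ?case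
        by simp
    qed
    then have "(\<phi> has_real_derivative Im (D * cnj (T u))) (at u)"
      using DERIV_cong_ev[OF refl _ refl] L by metis
    then show ?thesis
      using real_differentiable_def by blast
  qed
  then show ?thesis
    by (rule that[OF _ T\<phi>])
qed

text \<open>In the moving frame \<open>y = z T\<close>, where \<open>z\<close> satisfies along \<open>\<phi>\<close> the same linear system as
  \<open>-h' + i h\<close> for a solution \<open>h\<close> of the support equation. Choosing \<open>h\<close> with the right initial values,
  the two agree by uniqueness.\<close>

lemma self_similar_solution_is_support_curve:
  assumes "self_similar_solution c d y"
  obtains h \<phi> where "support_ode c d h" and "\<exists>\<theta>. h \<theta> \<noteq> 0"
    and "regular_reparam \<phi>" and "\<And>u. y u = support_curve h (\<phi> u)"
proof -
  from assms obtain T where nonconst: "\<exists>u w. y u \<noteq> y w" and tan: "unit_tangent_along y T"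
    and eqn: "\<And>u. if vector_derivative y (at u) \<noteq> 0
             then signed_curvature y T u \<noteq> 0 \<and>
                  c * (y u \<bullet> T u) - d * (y u \<bullet> normal T u) = 1 / signed_curvature y T u
             else vector_derivative T (at u) \<noteq> 0 \<and>
                  c * (y u \<bullet> T u) - d * (y u \<bullet> normal T u) = 0"
    unfolding self_similar_solution_def by blast
  from tan have y: "y differentiable (at u)" and T: "T differentiable (at u)"
    and n: "norm (T u) = 1" and "\<exists>v. vector_derivative y (at u) = v *\<^sub>R T u" for u
    unfolding unit_tangent_along_def by blast+
  then obtain v where v: "\<And>u. vector_derivative y (at u) = v u *\<^sub>R T u"
    by metis
  obtain \<phi> where \<phi>: "\<And>u. \<phi> differentiable (at u)" and T\<phi>: "\<And>u. T u = cis (\<phi> u)"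
    using differentiable_angle_function[OF T n] by blast
  define \<omega> where "\<omega> = deriv \<phi>"
  have \<omega>: "(\<phi> has_real_derivative \<omega> u) (at u)" for u
    using \<phi>[of u] by (simp add: \<omega>_def DERIV_deriv_iff_real_differentiable)
  have T': "(T has_vector_derivative \<omega> u *\<^sub>R (\<i> * T u)) (at u)" for u
    using has_vector_derivative_cis_comp[OF \<omega>] T\<phi> by presburger
  have y': "(y has_vector_derivative v u *\<^sub>R T u) (at u)" for u
    using y[of u] v[of u] vector_derivative_works by metis
  define z where "z u = y u * cnj (T u)" for u
  have TT: "T u * cnj (T u) = 1" for u
    using complex_norm_square[of "T u"] n[of u] by simp
  have yz: "y u = z u * T u" for u
    using TT[of u] by (simp add: z_def mult.commute mult.left_commute)
  have frame: "y u \<bullet> T u = Re (z u)" "y u \<bullet> normal T u = Im (z u)" for u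
    unfolding normal_def yz using inner_unit_frame[OF n] by blast+
  have "\<omega> u \<noteq> 0 \<and> v u = \<omega> u * (c * Re (z u) - d * Im (z u))" for u
    using eqn[of u] unfolding self_similar_clause_iff[OF v vector_derivative_at[OF T'] n]
    by (simp only: frame simp_thms)
  then have \<omega>0: "\<And>u. \<omega> u \<noteq> 0" and v: "\<And>u. v u = \<omega> u * (c * Re (z u) - d * Im (z u))"
    by blast+
  have "((\<lambda>u. y u * cnj (T u)) has_vector_derivative
      y u * cnj (\<omega> u *\<^sub>R (\<i> * T u)) + v u *\<^sub>R T u * cnj (T u)) (at u)" for u
    by (intro has_vector_derivative_mult has_vector_derivative_cnj y' T')
  moreover have "y u * cnj (\<omega> u *\<^sub>R (\<i> * T u)) + v u *\<^sub>R T u * cnj (T u) =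
      of_real (v u) - \<i> * \<omega> u * z u" for u
    using TT[of u] by (simp add: z_def scaleR_conv_of_real)
  ultimately have z': "(z has_vector_derivative of_real (v u) - \<i> * \<omega> u * z u) (at u)" for u
    by (simp add: z_def[abs_def])
  have p: "((\<lambda>u. Re (z u)) has_real_derivative \<omega> u * (c * Re (z u) + (1 - d) * Im (z u))) (at u)" for u
    using bounded_linear.has_vector_derivative[OF bounded_linear_Re z', of u]
    by (simp add: has_real_derivative_iff_has_vector_derivative v algebra_simps)
  have q: "((\<lambda>u. Im (z u)) has_real_derivative - (\<omega> u * Re (z u))) (at u)" for u
    using bounded_linear.has_vector_derivative[OF bounded_linear_Im z', of u]
    by (simp add: has_real_derivative_iff_has_vector_derivative)
  obtain h where h: "support_ode c d h" "h (\<phi> 0) = Im (z 0)" "deriv h (\<phi> 0) = - Re (z 0)"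
    by (rule support_ode_initial_value)
  have h\<phi>: "((\<lambda>u. h (\<phi> u)) has_real_derivative deriv h (\<phi> u) * \<omega> u) (at u)"
    "((\<lambda>u. deriv h (\<phi> u)) has_real_derivative
        (c * deriv h (\<phi> u) - (1 - d) * h (\<phi> u)) * \<omega> u) (at u)" for u
    using DERIV_chain2[OF support_odeD(1)[OF h(1)] \<omega>] DERIV_chain2[OF support_odeD(2)[OF h(1)] \<omega>] .
  define P Q where "P u = Re (z u) + deriv h (\<phi> u)" and "Q u = Im (z u) - h (\<phi> u)" for u
  have "(P has_real_derivative \<omega> u * (c * P u + (1 - d) * Q u)) (at u)" for u
    using DERIV_add[OF p[of u] h\<phi>(2)[of u]] by (simp add: P_def[abs_def] Q_def algebra_simps)
  moreover have "(Q has_real_derivative - (\<omega> u * P u)) (at u)" for u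
    using DERIV_diff[OF q[of u] h\<phi>(1)[of u]] by (simp add: P_def Q_def[abs_def] algebra_simps)
  moreover have "P 0 = 0" "Q 0 = 0"
    using h by (simp_all add: P_def Q_def)
  ultimately have "P u = 0" "Q u = 0" for u
    using uniqueness_along[OF \<omega>, of P c d Q 0] by blast+
  then have "z u = Complex (- deriv h (\<phi> u)) (h (\<phi> u))" for u
    by (simp add: P_def Q_def complex_eq_iff add_eq_0_iff)
  then have sc: "y u = support_curve h (\<phi> u)" for u
    by (simp add: yz support_curve_def T\<phi>)
  have "\<exists>\<theta>. h \<theta> \<noteq> 0"
  proof (rule ccontr)
    assume "\<nexists>\<theta>. h \<theta> \<noteq> 0"
    then have "h = (\<lambda>_. 0)" by auto
    then have "support_curve h \<theta> = 0" for \<theta>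
      by (simp add: support_curve_def complex_eq_iff)
    with nonconst sc show False by simp
  qed
  moreover have "regular_reparam \<phi>"
    using \<phi> \<omega>0 by (simp add: regular_reparam_def \<omega>_def)
  ultimately show ?thesis
    using that h(1) sc by blast
qed

section \<open>Rigidity and maximality\<close>

text \<open>Coinciding curves have the same tangent lines. So \<open>cis (2 \<phi> u - 2 u)\<close> is the same constant at
  all points where the speed does not vanish, and by continuity also at the cusps, which are
  isolated. Hence \<open>\<phi>\<close> is a translation. The constant \<open>\<mu>\<close> is real because it relates the two real
  radii of curvature.\<close>

lemma support_curve_rigidity:
  assumes cd: "(c, d) \<noteq> (0, 0)" and f: "support_ode c d f" and g: "support_ode c d g"
    and nz: "f \<theta>\<^sub>0 \<noteq> 0" and m: "m \<noteq> 0" and n: "n \<noteq> 0"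
    and \<phi>: "\<And>u. \<phi> differentiable (at u)"
    and eq: "\<And>u. m * support_curve f u = n * support_curve g (\<phi> u)"
  obtains k \<mu> where "\<And>u. \<phi> u = u + k" and "f = (\<lambda>\<theta>. \<mu> * g (\<theta> + k))"
proof -
  let ?f = "curvature_radius c d f" and ?g = "curvature_radius c d g"
  define \<omega> where "\<omega> = deriv \<phi>"
  have \<omega>: "(\<phi> has_real_derivative \<omega> u) (at u)" for u
    using \<phi>[of u] by (simp add: \<omega>_def DERIV_deriv_iff_real_differentiable)
  have vel: "?f u *\<^sub>R (m * cis u) = (\<omega> u * ?g (\<phi> u)) *\<^sub>R (n * cis (\<phi> u))" for u
  proof -
    have "((\<lambda>u. n * support_curve g (\<phi> u)) has_vector_derivative
        \<omega> u *\<^sub>R (- ?g (\<phi> u) *\<^sub>R (n * cis (\<phi> u)))) (at u)"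
      using vector_diff_chain_at[OF \<omega>[of u, unfolded has_real_derivative_iff_has_vector_derivative]
          support_curve_has_vector_derivative[OF g, of n]]
      by (simp only: o_def)
    then have "\<omega> u *\<^sub>R (- ?g (\<phi> u) *\<^sub>R (n * cis (\<phi> u))) = - ?f u *\<^sub>R (m * cis u)"
      using support_curve_has_vector_derivative[OF f, of m u] unfolding eq
      by (rule vector_derivative_unique_at)
    then show ?thesis by simp
  qed
  define G where "G u = cis (2 * (\<phi> u - u))" for u
  define C where "C = (sgn m / sgn n)\<^sup>2"
  have G': "(G has_vector_derivative (2 * (\<omega> u - 1)) *\<^sub>R (\<i> * G u)) (at u)" for u
    unfolding G_def by (rule has_vector_derivative_cis_comp) (auto intro!: derivative_eq_intros \<omega>)
  have G_regular: "G u = C" if "?f u \<noteq> 0" for u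
  proof -
    have "(sgn (?f u) *\<^sub>R (sgn m * cis u))\<^sup>2 = (sgn (\<omega> u * ?g (\<phi> u)) *\<^sub>R (sgn n * cis (\<phi> u)))\<^sup>2"
      using arg_cong[OF vel[of u], of sgn] by (simp add: sgn_scaleR sgn_mult)
    moreover have "\<omega> u * ?g (\<phi> u) \<noteq> 0"
      using vel[of u] that m by auto
    ultimately have "(sgn m * cis u)\<^sup>2 = (sgn n * cis (\<phi> u))\<^sup>2"
      using that by (auto simp: sgn_real_def split: if_splits)
    then have "(sgn m)\<^sup>2 = (sgn n)\<^sup>2 * (cis (\<phi> u) / cis u)\<^sup>2"
      by (simp add: power_mult_distrib power_divide nonzero_eq_divide_eq)
    moreover have "(cis (\<phi> u) / cis u)\<^sup>2 = G u"
      by (simp add: G_def cis_divide power2_eq_square cis_mult)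
    ultimately show ?thesis
      using n by (simp add: C_def power_divide sgn_zero_iff)
  qed
  have "G u = C" for u
  proof (cases "?f u = 0")
    case True
    have ev: "\<forall>\<^sub>F w in at u. G w = C"
      using eventually_sgn_at_simple_zero[OF curvature_radius_deriv[OF f] True
          curvature_radius_simple_zeros[OF cd f nz True]]
        eventually_neq_at_within[of u u UNIV]
    proof eventually_elim
      case (elim w)
      then have "?f w \<noteq> 0"
        using curvature_radius_simple_zeros[OF cd f nz True] by (auto simp: sgn_zero_iff)
      then show ?case by (rule G_regular)
    qed
    have "(G \<longlongrightarrow> G u) (at u)"
      using has_vector_derivative_continuous[OF G'] by (simp add: continuous_within)
    moreover have "(G \<longlongrightarrow> C) (at u)"
      using ev by (rule tendsto_eventually)
    ultimately show ?thesis
      using tendsto_unique trivial_limit_at by blast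
  qed (rule G_regular)
  then have "G = (\<lambda>_. C)" by blast
  then have "(2 * (\<omega> u - 1)) *\<^sub>R (\<i> * G u) = 0" for u
    using G'[of u] has_vector_derivative_const vector_derivative_unique_at by metis
  then have \<omega>1: "\<omega> u = 1" for u
    by (simp add: G_def)
  have "((\<lambda>u. \<phi> u - u) has_real_derivative 0) (at u)" for u
    using DERIV_diff[OF \<omega> DERIV_ident, of u] by (simp add: \<omega>1)
  then have "\<phi> u - u = \<phi> 0 - 0" for u
    using DERIV_isconst_all[of "\<lambda>u. \<phi> u - u" u 0] by blast
  then have \<phi>0: "\<phi> u = u + \<phi> 0" for u
    using eq_diff_eq[of "\<phi> u"] by (metis add.commute diff_add_cancel diff_zero)
  define k where "k = \<phi> 0"
  have \<phi>k: "\<phi> u = u + k" for u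
    unfolding k_def by (rule \<phi>0)
  define \<mu> where "\<mu> = n * cis k / m"
  have cis_k: "cis (u + k) = cis u * cis k" for u
    by (simp add: cis_mult)
  have f_g: "of_real (?f u) = \<mu> * of_real (?g (u + k))" for u
  proof -
    have "(of_real (?f u) * m) * cis u = (of_real (?g (u + k)) * (n * cis k)) * cis u"
      using vel[of u] by (simp only: \<omega>1 \<phi>k cis_k scaleR_conv_of_real mult_1 mult_ac)
    then have "of_real (?f u) * m = of_real (?g (u + k)) * (n * cis k)"
      by (simp only: mult_cancel_right cis_neq_zero simp_thms)
    then show ?thesis
      using m by (simp add: \<mu>_def field_simps)
  qed
  obtain \<theta> where "?f \<theta> \<noteq> 0"
    by (rule curvature_radius_not_identically_zero[OF cd f nz])
  then have "?g (\<theta> + k) \<noteq> 0"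
    using f_g[of \<theta>] by auto
  moreover have "Im \<mu> * ?g (\<theta> + k) = 0"
    using arg_cong[OF f_g[of \<theta>], of Im] by simp
  ultimately have "Im \<mu> = 0"
    by simp
  then have \<mu>: "\<mu> = of_real (Re \<mu>)"
    by (simp add: complex_eq_iff)
  have "Complex (- deriv f u) (f u) = \<mu> * Complex (- deriv g (u + k)) (g (u + k))" for u
  proof -
    have "(m * Complex (- deriv f u) (f u)) * cis u =
        (n * cis k * Complex (- deriv g (u + k)) (g (u + k))) * cis u"
      using eq[of u] by (simp only: support_curve_def \<phi>k cis_k mult_ac)
    then have "m * Complex (- deriv f u) (f u) = n * cis k * Complex (- deriv g (u + k)) (g (u + k))"
      by (simp only: mult_cancel_right cis_neq_zero simp_thms)
    then show ?thesis
      using m by (simp add: \<mu>_def field_simps)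
  qed
  then have "f u = Im (of_real (Re \<mu>) * Complex (- deriv g (u + k)) (g (u + k)))" for u
    using \<mu> by (metis complex.sel(2))
  then have "f = (\<lambda>u. Re \<mu> * g (u + k))"
    by (simp add: fun_eq_iff)
  with \<phi>k that show ?thesis by blast
qed

lemma regular_reparam_inj:
  assumes "regular_reparam \<phi>"
  shows "inj \<phi>"
proof (rule linorder_injI)
  fix a b :: real
  assume "a < b"
  have "(\<phi> has_real_derivative deriv \<phi> u) (at u)" and "deriv \<phi> u \<noteq> 0" for u
    using assms by (auto simp: regular_reparam_def DERIV_deriv_iff_real_differentiable)
  then show "\<phi> a \<noteq> \<phi> b"
    using MVT2[OF \<open>a < b\<close>, of \<phi> "deriv \<phi>"] \<open>a < b\<close> by auto
qed

lemma regular_reparam_comp: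
  assumes "regular_reparam \<phi>" "regular_reparam \<psi>"
  shows "regular_reparam (\<lambda>u. \<phi> (\<psi> u))"
proof -
  have "((\<lambda>u. \<phi> (\<psi> u)) has_real_derivative deriv \<phi> (\<psi> u) * deriv \<psi> u) (at u)" for u
    using assms by (auto simp: regular_reparam_def DERIV_deriv_iff_real_differentiable intro: DERIV_chain2)
  note this DERIV_imp_deriv[OF this]
  then show ?thesis
    using assms by (metis mult_eq_0_iff real_differentiable_def regular_reparam_def)
qed

text \<open>If the curve is \<open>y \<circ> \<phi>\<close>, then \<open>y\<close> itself is a reparametrization by some \<open>\<psi>\<close> of a support curve.
  By rigidity \<open>\<psi> \<circ> \<phi>\<close> is a translation, and since \<open>\<psi>\<close> is injective, \<open>\<phi>\<close> is onto.\<close>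

lemma support_curve_maximal:
  assumes cd: "(c, d) \<noteq> (0, 0)" and h: "support_ode c d h" and nz: "h \<theta>\<^sub>0 \<noteq> 0" and m: "m \<noteq> 0"
  shows "maximal_solution c d (\<lambda>\<theta>. m * support_curve h \<theta>)"
  unfolding maximal_solution_def
proof (intro conjI allI impI)
  show "self_similar_solution c d (\<lambda>\<theta>. m * support_curve h \<theta>)"
    by (rule support_curve_self_similar[OF assms])
  fix y \<phi>
  assume "self_similar_solution c d y \<and> regular_reparam \<phi> \<and> (\<lambda>\<theta>. m * support_curve h \<theta>) = y \<circ> \<phi>"
  then have y: "self_similar_solution c d y" and \<phi>: "regular_reparam \<phi>"
    and eq: "\<And>u. m * support_curve h u = y (\<phi> u)"
    by (auto simp: fun_eq_iff)
  obtain g \<psi> where g: "support_ode c d g" and \<psi>: "regular_reparam \<psi>"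
    and y: "\<And>u. y u = support_curve g (\<psi> u)"
    using self_similar_solution_is_support_curve[OF y] by metis
  have "regular_reparam (\<lambda>u. \<psi> (\<phi> u))"
    by (rule regular_reparam_comp[OF \<psi> \<phi>])
  moreover have "m * support_curve h u = 1 * support_curve g (\<psi> (\<phi> u))" for u
    by (simp add: eq y)
  ultimately obtain k where k: "\<And>u. \<psi> (\<phi> u) = u + k"
    using support_curve_rigidity[OF cd h g nz m, of 1 "\<lambda>u. \<psi> (\<phi> u)"]
    unfolding regular_reparam_def by (metis zero_neq_one)
  have "\<phi> (\<psi> t - k) = t" for t
    using k[of "\<psi> t - k"] regular_reparam_inj[OF \<psi>] by (simp add: inj_eq)
  then show "surj \<phi>"
    by (metis surj_def)
qed

text \<open>The classification of curves is reduced to a classification of functions: a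
  rotation of the curve is a translation of its support function and a scaling is a multiplication
  by a positive factor. A negative factor is allowed as well, because \<open>-1\<close> is a rotation.\<close>

lemma solutions_up_to_rot_scale_support_curves:
  assumes cd: "(c, d) \<noteq> (0, 0)"
    and xs: "\<And>i. i < length xs \<Longrightarrow> \<exists>m. m \<noteq> 0 \<and> xs ! i = (\<lambda>\<theta>. m * support_curve (hs ! i) \<theta>)"
    and hs: "\<And>i. i < length xs \<Longrightarrow> support_ode c d (hs ! i) \<and> (\<exists>\<theta>. (hs ! i) \<theta> \<noteq> 0)"
    and distinct: "\<And>i j \<mu> k. i < length xs \<Longrightarrow> j < length xs \<Longrightarrow>
       hs ! j = (\<lambda>\<theta>. \<mu> * (hs ! i) (\<theta> + k)) \<Longrightarrow> i = j"
    and complete: "\<And>h. support_ode c d h \<Longrightarrow> \<exists>\<theta>. h \<theta> \<noteq> 0 \<Longrightarrow>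
       \<exists>i < length xs. \<exists>\<mu> k. h = (\<lambda>\<theta>. \<mu> * (hs ! i) (\<theta> + k))"
  shows "solutions_up_to_rot_scale c d xs"
  unfolding solutions_up_to_rot_scale_def
proof (intro conjI allI ballI impI)
  fix x assume "x \<in> set xs"
  then obtain i where i: "i < length xs" "x = xs ! i"
    by (metis in_set_conv_nth)
  then obtain m \<theta> where m: "m \<noteq> 0" "x = (\<lambda>\<theta>. m * support_curve (hs ! i) \<theta>)" "(hs ! i) \<theta> \<noteq> 0"
    using xs hs by blast
  show "maximal_solution c d x"
    unfolding m(2) by (rule support_curve_maximal[OF cd conjunct1[OF hs[OF i(1)]] m(3,1)])
next
  fix i j
  assume i: "i < length xs" and j: "j < length xs"
    and "same_up_to_rot_scale (xs ! i) (xs ! j)"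
  then obtain r \<alpha> \<phi> where r: "r > 0" and \<phi>: "regular_reparam \<phi>"
    and eq: "xs ! j = (\<lambda>u. of_real r * cis \<alpha> * (xs ! i) (\<phi> u))"
    unfolding same_up_to_rot_scale_def by blast
  obtain m where m: "m \<noteq> 0" "xs ! i = (\<lambda>\<theta>. m * support_curve (hs ! i) \<theta>)"
    using xs[OF i] by blast
  obtain n where n: "n \<noteq> 0" "xs ! j = (\<lambda>\<theta>. n * support_curve (hs ! j) \<theta>)"
    using xs[OF j] by blast
  obtain \<theta> where \<theta>: "(hs ! j) \<theta> \<noteq> 0"
    using hs[OF j] by blast
  have eq': "n * support_curve (hs ! j) u = of_real r * cis \<alpha> * m * support_curve (hs ! i) (\<phi> u)" for u
    using fun_cong[OF eq, of u] by (simp add: m(2) n(2))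
  have "of_real r * cis \<alpha> * m \<noteq> 0"
    using r m(1) by simp
  moreover have "\<And>u. \<phi> differentiable (at u)"
    using \<phi> by (simp add: regular_reparam_def)
  ultimately obtain k \<mu> where "hs ! j = (\<lambda>\<theta>. \<mu> * (hs ! i) (\<theta> + k))"
    using support_curve_rigidity[OF cd conjunct1[OF hs[OF j]] conjunct1[OF hs[OF i]] \<theta> n(1) _ _ eq']
    by blast
  then show "i = j"
    by (rule distinct[OF i j])
next
  fix y assume "maximal_solution c d y"
  then have y: "self_similar_solution c d y" and
    max: "\<And>y' \<phi>. self_similar_solution c d y' \<Longrightarrow> regular_reparam \<phi> \<Longrightarrow> y = y' \<circ> \<phi> \<Longrightarrow> surj \<phi>"
    unfolding maximal_solution_def by blast+
  obtain h \<phi> where h: "support_ode c d h" "\<exists>\<theta>. h \<theta> \<noteq> 0" and \<phi>: "regular_reparam \<phi>"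
    and yh: "\<And>u. y u = support_curve h (\<phi> u)"
    using self_similar_solution_is_support_curve[OF y] by metis
  obtain \<theta>\<^sub>0 where "h \<theta>\<^sub>0 \<noteq> 0"
    using h(2) by blast
  have surj: "surj \<phi>"
  proof (rule max[OF _ \<phi>])
    show "self_similar_solution c d (\<lambda>\<theta>. 1 * support_curve h \<theta>)"
      by (rule support_curve_self_similar[OF cd h(1) \<open>h \<theta>\<^sub>0 \<noteq> 0\<close>]) simp
  qed (simp add: yh fun_eq_iff)
  obtain i \<mu> k where i: "i < length xs" and h_eq: "h = (\<lambda>\<theta>. \<mu> * (hs ! i) (\<theta> + k))"
    using complete[OF h] by blast
  obtain m where m: "m \<noteq> 0" "xs ! i = (\<lambda>\<theta>. m * support_curve (hs ! i) \<theta>)"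
    using xs[OF i] by blast
  have "\<mu> \<noteq> 0"
    using h(2) h_eq by auto
  have f: "support_ode c d (hs ! i)"
    using hs[OF i] by blast
  have "deriv h = (\<lambda>\<theta>. \<mu> * deriv (hs ! i) (\<theta> + k))"
    unfolding h_eq
    using support_ode_lincomb(2)[OF support_ode_shift(1)[OF f, of k] support_ode_shift(1)[OF f, of k], of \<mu> 0]
    by (simp add: support_ode_shift(2)[OF f])
  then have "support_curve h \<theta> = of_real \<mu> * cis (- k) * support_curve (hs ! i) (\<theta> + k)" for \<theta>
  proof -
    have "cis \<theta> = cis (- k) * cis (\<theta> + k)"
      by (simp add: cis_mult)
    moreover have "Complex (- deriv h \<theta>) (h \<theta>) =
        of_real \<mu> * Complex (- deriv (hs ! i) (\<theta> + k)) ((hs ! i) (\<theta> + k))"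
      using \<open>deriv h = _\<close> by (simp add: h_eq complex_eq_iff)
    ultimately show ?thesis
      unfolding support_curve_def by algebra
  qed
  then have y_eq: "y u = of_real \<mu> * cis (- k) / m * (xs ! i) (\<phi> u + k)" for u
    using m by (simp add: yh)
  define a where "a = of_real \<mu> * cis (- k) / m"
  have "a \<noteq> 0"
    using \<open>\<mu> \<noteq> 0\<close> m(1) by (simp add: a_def)
  have "same_up_to_rot_scale (xs ! i) y"
    unfolding same_up_to_rot_scale_def
  proof (intro exI conjI)
    show "norm a > 0" using \<open>a \<noteq> 0\<close> by simp
    have "regular_reparam (\<lambda>t. t + k)"
      by (auto simp: regular_reparam_def intro!: derivative_intros)
    then show "regular_reparam (\<lambda>u. \<phi> u + k)"
      by (rule regular_reparam_comp[OF _ \<phi>])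
    show "surj (\<lambda>u. \<phi> u + k)"
      using surj unfolding surj_def by (metis diff_add_cancel)
    show "y = (\<lambda>u. of_real (norm a) * cis (Arg a) * (xs ! i) (\<phi> u + k))"
      using y_eq rcis_cmod_Arg[of a] by (simp add: a_def rcis_def fun_eq_iff)
  qed
  then show "\<exists>x\<in>set xs. same_up_to_rot_scale x y"
    using i nth_mem by blast
qed

section \<open>Exponential support functions and asymptotics\<close>

lemma exp_Complex_times_of_real: "exp (Complex a b * of_real t) = of_real (exp (a * t)) * cis (b * t)"
  by (simp add: exp_eq_polar)

lemma support_ode_exp:
  assumes "\<sigma>\<^sup>2 = c * \<sigma> - (1 - d)"
  shows "support_ode c d (\<lambda>\<theta>. exp (\<sigma> * \<theta>))" and "deriv (\<lambda>\<theta>. exp (\<sigma> * \<theta>)) = (\<lambda>\<theta>. \<sigma> * exp (\<sigma> * \<theta>))"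
proof -
  have 1: "((\<lambda>\<theta>. exp (\<sigma> * \<theta>)) has_real_derivative \<sigma> * exp (\<sigma> * \<theta>)) (at \<theta>)" for \<theta>
    by (auto intro!: derivative_eq_intros)
  have "((\<lambda>\<theta>. \<sigma> * exp (\<sigma> * \<theta>)) has_real_derivative \<sigma>\<^sup>2 * exp (\<sigma> * \<theta>)) (at \<theta>)" for \<theta>
    by (auto intro!: derivative_eq_intros simp: power2_eq_square)
  moreover have "\<sigma>\<^sup>2 * e = c * (\<sigma> * e) - (1 - d) * e" for e
    by (simp add: assms algebra_simps)
  ultimately have 2: "((\<lambda>\<theta>. \<sigma> * exp (\<sigma> * \<theta>)) has_real_derivative
      c * (\<sigma> * exp (\<sigma> * \<theta>)) - (1 - d) * exp (\<sigma> * \<theta>)) (at \<theta>)" for \<theta>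
    by simp
  show "support_ode c d (\<lambda>\<theta>. exp (\<sigma> * \<theta>))" "deriv (\<lambda>\<theta>. exp (\<sigma> * \<theta>)) = (\<lambda>\<theta>. \<sigma> * exp (\<sigma> * \<theta>))"
    using support_odeI[OF 1 2] by blast+
qed

lemma spiral_as_support_curve:
  assumes "\<sigma>\<^sup>2 = c * \<sigma> - (1 - d)"
  shows "exp (Complex \<sigma> 1 * of_real \<theta>) = inverse (Complex (- \<sigma>) 1) * support_curve (\<lambda>\<theta>. exp (\<sigma> * \<theta>)) \<theta>"
proof -
  have "Complex (- (\<sigma> * e)) e = of_real e * Complex (- \<sigma>) 1" for e
    by (simp add: complex_eq_iff)
  moreover have "Complex (- \<sigma>) 1 \<noteq> 0"
    by (simp add: complex_eq_iff)
  ultimately show ?thesis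
    by (simp add: exp_Complex_times_of_real support_curve_def support_ode_exp(2)[OF assms])
qed

lemma spiral_or_circle:
  "if \<rho> = 0 then origin_circle (\<lambda>\<theta>. exp (Complex \<rho> 1 * of_real \<theta>))
   else logarithmic_spiral (\<lambda>\<theta>. exp (Complex \<rho> 1 * of_real \<theta>))"
proof -
  have "(\<lambda>\<theta>. exp (Complex \<rho> 1 * of_real \<theta>)) = (\<lambda>\<theta>. 1 * exp (Complex \<rho> 1 * of_real \<theta>))"
    by simp
  then show ?thesis
    unfolding origin_circle_def logarithmic_spiral_def by (metis zero_neq_one)
qed

text \<open>On a bounded range of \<open>h\<close> the factor \<open>B h\<close> is bounded, so a separated error that vanishes in
  the limit vanishes uniformly. All error terms below separate because of the
  functional equation of \<open>exp\<close>.\<close>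

lemma asymptotic_shapeI:
  assumes eq: "\<forall>\<^sub>F \<theta> in F. \<forall>h. x (\<theta> + h) / x \<theta> - y (\<theta> + h) / y \<theta> = B h * \<epsilon> \<theta>"
    and B: "continuous_on UNIV B" and \<epsilon>: "(\<epsilon> \<longlongrightarrow> 0) F"
  shows "asymptotic_shape F x y"
  unfolding asymptotic_shape_def uniform_limit_iff
proof (intro allI impI)
  fix R e :: real
  assume "e > 0"
  have "bounded (B ` {-R..R})"
    by (intro compact_imp_bounded compact_continuous_image continuous_on_subset[OF B]) auto
  then obtain M where M: "M > 0" "\<And>h. h \<in> {-R..R} \<Longrightarrow> norm (B h) \<le> M"
    unfolding bounded_pos by auto
  have "\<forall>\<^sub>F \<theta> in F. norm (\<epsilon> \<theta>) < e / M"
    using tendstoD[OF \<epsilon>, of "e / M"] \<open>e > 0\<close> M(1) by simp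
  with eq show "\<forall>\<^sub>F \<theta> in F. \<forall>h\<in>{-R..R}. dist (x (\<theta> + h) / x \<theta> - y (\<theta> + h) / y \<theta>) 0 < e"
  proof eventually_elim
    case (elim \<theta>)
    show ?case
    proof
      fix h assume "h \<in> {-R..R}"
      then have "norm (B h * \<epsilon> \<theta>) \<le> M * norm (\<epsilon> \<theta>)"
        using M by (simp add: norm_mult mult_right_mono)
      also have "\<dots> < e"
        using elim(2) M(1) by (simp add: field_simps)
      finally show "dist (x (\<theta> + h) / x \<theta> - y (\<theta> + h) / y \<theta>) 0 < e"
        using elim(1) by simp
    qed
  qed
qed

lemma asymptotic_dominant_exponential:
  fixes a b z w :: complex
  assumes a: "a \<noteq> 0" and lim: "((\<lambda>\<theta>. exp ((w - z) * of_real \<theta>)) \<longlongrightarrow> 0) F"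
    and x: "\<And>\<theta>. x \<theta> = exp (z * of_real \<theta>) * a + exp (w * of_real \<theta>) * b"
  defines "y \<equiv> \<lambda>\<theta>. exp (z * of_real \<theta>)"
  shows "asymptotic_ratio F x y" and "asymptotic_shape F x y"
proof -
  define r where "r \<theta> = a + b * exp ((w - z) * of_real \<theta>)" for \<theta> :: real
  have xr: "x \<theta> = y \<theta> * r \<theta>" for \<theta>
    by (simp add: x y_def r_def algebra_simps flip: exp_add)
  have y0: "y \<theta> \<noteq> 0" for \<theta>
    by (simp add: y_def)
  have "(r \<longlongrightarrow> a + b * 0) F"
    unfolding r_def by (intro tendsto_intros lim)
  then have r: "(r \<longlongrightarrow> a) F" by simp
  have "((\<lambda>\<theta>. x \<theta> / (a * y \<theta>)) \<longlongrightarrow> a / a) F"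
    using tendsto_divide[OF r tendsto_const[of a] a] y0 by (simp add: xr mult.commute)
  then have "x \<sim>[F] (\<lambda>\<theta>. a * y \<theta>)"
    using a by (intro asymp_equivI') simp
  with a show "asymptotic_ratio F x y"
    unfolding asymptotic_ratio_def by blast
  let ?B = "\<lambda>h. exp (z * of_real h) * (exp ((w - z) * of_real h) - 1)"
  let ?\<epsilon> = "\<lambda>\<theta>. b * exp ((w - z) * of_real \<theta>) / r \<theta>"
  show "asymptotic_shape F x y"
  proof (rule asymptotic_shapeI)
    have "\<forall>\<^sub>F \<theta> in F. r \<theta> \<noteq> 0"
      using tendsto_imp_eventually_ne[OF r a] .
    then show "\<forall>\<^sub>F \<theta> in F. \<forall>h. x (\<theta> + h) / x \<theta> - y (\<theta> + h) / y \<theta> = ?B h * ?\<epsilon> \<theta>"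
    proof eventually_elim
      case (elim \<theta>)
      show ?case
      proof
        fix h
        have y_add: "y (\<theta> + h) = y \<theta> * exp (z * of_real h)"
          by (simp add: y_def distrib_left exp_add)
        have r_add: "r (\<theta> + h) - r \<theta> = b * exp ((w - z) * of_real \<theta>) * (exp ((w - z) * of_real h) - 1)"
          by (simp add: r_def algebra_simps flip: exp_add)
        have "x (\<theta> + h) / x \<theta> - y (\<theta> + h) / y \<theta> = exp (z * of_real h) * ((r (\<theta> + h) - r \<theta>) / r \<theta>)"
          using elim y0[of \<theta>] by (simp add: xr y_add field_simps)
        then show "x (\<theta> + h) / x \<theta> - y (\<theta> + h) / y \<theta> = ?B h * ?\<epsilon> \<theta>"
          by (simp add: r_add mult_ac)
      qed
    qed
    show "continuous_on UNIV ?B"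
      by (intro continuous_intros)
    have "(?\<epsilon> \<longlongrightarrow> b * 0 / a) F"
      by (intro tendsto_intros lim r a)
    then show "(?\<epsilon> \<longlongrightarrow> 0) F" by simp
  qed
qed

lemma exp_complex_tendsto_0:
  assumes "((\<lambda>\<theta>. exp (Re w * \<theta>)) \<longlongrightarrow> 0) F"
  shows "((\<lambda>\<theta>. exp (w * of_real \<theta>)) \<longlongrightarrow> 0) F"
  by (rule tendsto_norm_zero_cancel) (use assms in simp)

section \<open>The undercritical case\<close>

lemma periodic_int_multiple:
  fixes f :: "real \<Rightarrow> 'a"
  assumes "\<And>t. f (t + p) = f t"
  shows "f (t + of_int j * p) = f t"
proof (induction j rule: int_induct[of _ 0])
  case (step1 i)
  then show ?case
    using assms[of "t + of_int i * p"] by (simp add: algebra_simps)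
next
  case (step2 i)
  then show ?case
    using assms[of "t + of_int (i - 1) * p"] by (simp add: algebra_simps)
qed simp

text \<open>Here \<open>exp (c \<theta> / 2) cos (K \<theta>)\<close> is a support function of \<open>X\<close> up to a factor. The radius of
  curvature is again \<open>exp (c \<theta> / 2)\<close> times a cosine of frequency \<open>K\<close>, with zeros spaced by
  \<open>p = \<pi> / K\<close>. Increasing \<open>\<theta>\<close> by \<open>p\<close> multiplies \<open>X\<close> by \<open>q = - exp ((c/2 + i) p)\<close>, and the spiral of exponent \<open>c/2 + (1 + K) i\<close> is multiplied by \<open>q\<close>
  as well because \<open>cis (K p) = -1\<close>. So the spiral that passes through one cusp contains all of them.\<close>

lemma classification_undercritical:
  fixes c d :: real
  assumes cd: "(c, d) \<noteq> (0, 0)" and under: "c\<^sup>2 < 4 * (1 - d)"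
  defines "K \<equiv> sqrt (1 - d - c\<^sup>2 / 4)"
  defines "X \<equiv> (\<lambda>\<theta>. exp (Complex (c/2) (K + 1) * of_real \<theta>) * Complex (- c/2) (1 - K)
                  + exp (Complex (c/2) (1 - K) * of_real \<theta>) * Complex (- c/2) (1 + K))"
  shows "solutions_up_to_rot_scale c d [X] \<and> tangent_angle_param X \<and>
          (\<exists>b. (if c = 0 then origin_circle b else logarithmic_spiral b) \<and> cycloid_along X b) \<and>
          infinite {\<theta>. cusp X \<theta>}"
proof -
  have K0: "K > 0" and K2: "K\<^sup>2 = 1 - d - c\<^sup>2 / 4"
    using under by (simp_all add: K_def)
  define h where "h = (\<lambda>\<theta>. exp (c / 2 * \<theta>) * cos (K * \<theta>))"
  define s where "s = (\<lambda>\<theta>. exp (c / 2 * \<theta>) * (sin (K * \<theta>) / K))"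
  have CS: "((\<lambda>\<theta>. sin (K * \<theta>) / K) has_real_derivative cos (K * \<theta>)) (at \<theta>)"
    "((\<lambda>\<theta>. cos (K * \<theta>)) has_real_derivative (c\<^sup>2 / 4 + d - 1) * (sin (K * \<theta>) / K)) (at \<theta>)" for \<theta>
  proof -
    show "((\<lambda>\<theta>. sin (K * \<theta>) / K) has_real_derivative cos (K * \<theta>)) (at \<theta>)"
      using K0 by (auto intro!: derivative_eq_intros)
    have "((\<lambda>\<theta>. cos (K * \<theta>)) has_real_derivative - K\<^sup>2 * (sin (K * \<theta>) / K)) (at \<theta>)"
      using K0 by (auto intro!: derivative_eq_intros simp: power2_eq_square)
    moreover have "- K\<^sup>2 = c\<^sup>2 / 4 + d - 1"
      using K2 by simp
    ultimately show "((\<lambda>\<theta>. cos (K * \<theta>)) has_real_derivative (c\<^sup>2 / 4 + d - 1) * (sin (K * \<theta>) / K)) (at \<theta>)"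
      by (simp only:)
  qed
  have h: "support_ode c d h"
    by (rule support_ode_exp_times(3)[OF CS s_def h_def])
  have "deriv h = (\<lambda>\<theta>. c / 2 * h \<theta> + (c\<^sup>2 / 4 + d - 1) * s \<theta>)"
    by (rule support_ode_exp_times(4)[OF CS s_def h_def])
  moreover have "c\<^sup>2 / 4 + d - 1 = - (K * K)"
    using K2 by (simp add: power2_eq_square)
  ultimately have "deriv h \<theta> = c / 2 * h \<theta> - K * K * s \<theta>" for \<theta>
    by simp
  moreover have "K * K * s \<theta> = exp (c / 2 * \<theta>) * (K * sin (K * \<theta>))" for \<theta>
    using K0 by (simp add: s_def)
  ultimately have h': "deriv h \<theta> = exp (c / 2 * \<theta>) * (c / 2 * cos (K * \<theta>) - K * sin (K * \<theta>))" for \<theta>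
    by (simp only:) (simp add: h_def algebra_simps)
  have nz: "h 0 \<noteq> 0"
    by (simp add: h_def)
  have X: "X = (\<lambda>\<theta>. 2 * support_curve h \<theta>)"
  proof
    fix \<theta>
    have cis: "cis ((K + 1) * \<theta>) = cis (K * \<theta>) * cis \<theta>" "cis ((1 - K) * \<theta>) = cnj (cis (K * \<theta>)) * cis \<theta>"
      by (simp_all add: cis_mult cis_cnj algebra_simps)
    have "X \<theta> = (cis (K * \<theta>) * Complex (- c/2) (1 - K) + cnj (cis (K * \<theta>)) * Complex (- c/2) (1 + K))
        * of_real (exp (c / 2 * \<theta>)) * cis \<theta>"
      unfolding X_def exp_Complex_times_of_real cis by (simp add: algebra_simps)
    also have "(cis (K * \<theta>) * Complex (- c/2) (1 - K) + cnj (cis (K * \<theta>)) * Complex (- c/2) (1 + K))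
        * of_real (exp (c / 2 * \<theta>)) = 2 * Complex (- deriv h \<theta>) (h \<theta>)"
      unfolding h' by (simp add: complex_eq_iff h_def algebra_simps)
    finally show "X \<theta> = 2 * support_curve h \<theta>"
      by (simp add: support_curve_def)
  qed
  have sol: "solutions_up_to_rot_scale c d [X]"
  proof (rule solutions_up_to_rot_scale_support_curves[OF cd, where hs = "[h]"])
    show "\<exists>m. m \<noteq> 0 \<and> [X] ! i = (\<lambda>\<theta>. m * support_curve ([h] ! i) \<theta>)" if "i < length [X]" for i
      using that X by (intro exI[of _ 2]) simp
    show "support_ode c d ([h] ! i) \<and> (\<exists>\<theta>. ([h] ! i) \<theta> \<noteq> 0)" if "i < length [X]" for i
      using that h nz by auto
    show "i = j" if "i < length [X]" "j < length [X]" for i j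
      using that by simp
    fix g assume g: "support_ode c d g"
    have "cos (K * 0) = 1" "sin (K * 0) / K = 0"
      by simp_all
    then obtain A B where AB: "\<And>\<theta>. g \<theta> = exp (c / 2 * \<theta>) * (A * cos (K * \<theta>) + B * (sin (K * \<theta>) / K))"
      using support_ode_general_solution[OF CS _ _ g] by metis
    \<comment> \<open>Amplitude and phase of the oscillation; the phase is absorbed by the translation.\<close>
    define R \<delta> where "R = cmod (Complex A (- B / K))" and "\<delta> = Arg (Complex A (- B / K))"
    have "Complex A (- B / K) = rcis R \<delta>"
      by (simp only: R_def \<delta>_def rcis_cmod_Arg)
    then have AR: "A = R * cos \<delta>" and BR: "B / K = - (R * sin \<delta>)"
      by (simp_all add: complex_eq_iff)
    have AB_R: "A * cos (K * \<theta>) + B * (sin (K * \<theta>) / K) = R * cos (K * \<theta> + \<delta>)" for \<theta>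
    proof -
      have "A * cos (K * \<theta>) + B * (sin (K * \<theta>) / K) = A * cos (K * \<theta>) + B / K * sin (K * \<theta>)"
        by simp
      also have "\<dots> = R * cos (K * \<theta> + \<delta>)"
        unfolding AR BR by (simp add: cos_add algebra_simps)
      finally show ?thesis .
    qed
    have "g \<theta> = R * exp (- (c / 2 * (\<delta> / K))) * h (\<theta> + \<delta> / K)" for \<theta>
    proof -
      have "exp (c / 2 * \<theta>) = exp (- (c / 2 * (\<delta> / K))) * exp (c / 2 * (\<theta> + \<delta> / K))"
        by (simp add: distrib_left flip: exp_add)
      moreover have "K * (\<theta> + \<delta> / K) = K * \<theta> + \<delta>"
        using K0 by (simp add: distrib_left)
      ultimately show ?thesis
        by (simp only: AB AB_R h_def mult_ac)
    qed
    then have "g = (\<lambda>\<theta>. R * exp (- (c / 2 * (\<delta> / K))) * h (\<theta> + \<delta> / K))"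
      by blast
    then show "\<exists>i < length [X]. \<exists>\<mu> k. g = (\<lambda>\<theta>. \<mu> * ([h] ! i) (\<theta> + k))"
      by (intro exI[of _ 0]) auto
  qed
  define w where "w = Complex (c\<^sup>2 / 2 + d) (c * K)"
  have "w \<noteq> 0"
    using cd K0 by (auto simp: w_def complex_eq_iff)
  define \<theta>\<^sub>0 p where "\<theta>\<^sub>0 = (pi / 2 - Arg w) / K" and "p = pi / K"
  have p0: "p > 0"
    using K0 by (simp add: p_def)
  have cusp_iff: "cusp X \<theta> \<longleftrightarrow> curvature_radius c d h \<theta> = 0" for \<theta>
    unfolding X by (rule cusp_support_curve_iff[OF cd h nz]) simp
  have "curvature_radius c d h \<theta> = 0 \<longleftrightarrow> \<theta> \<in> range (\<lambda>j::int. \<theta>\<^sub>0 + of_int j * p)" for \<theta>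
  proof -
    have "curvature_radius c d h \<theta> = exp (c / 2 * \<theta>) * Re (w * cis (K * \<theta>))"
      unfolding curvature_radius_def h' by (simp add: h_def w_def algebra_simps power2_eq_square)
    also have "w * cis (K * \<theta>) = rcis (cmod w) (Arg w + K * \<theta>)"
      by (metis cis_rcis_eq mult.right_neutral rcis_cmod_Arg rcis_mult)
    finally have "curvature_radius c d h \<theta> = 0 \<longleftrightarrow> cos (Arg w + K * \<theta>) = 0"
      using \<open>w \<noteq> 0\<close> by simp
    also have "\<dots> \<longleftrightarrow> (\<exists>j::int. Arg w + K * \<theta> = of_int j * pi + pi / 2)"
      by (rule cos_zero_iff_int2)
    also have "\<dots> \<longleftrightarrow> \<theta> \<in> range (\<lambda>j::int. \<theta>\<^sub>0 + of_int j * p)"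
      using K0 by (auto simp: image_iff \<theta>\<^sub>0_def p_def field_simps)
    finally show ?thesis .
  qed
  with cusp_iff have cusps: "{\<theta>. cusp X \<theta>} = range (\<lambda>j::int. \<theta>\<^sub>0 + of_int j * p)"
    by blast
  have "inj (\<lambda>j::int. \<theta>\<^sub>0 + of_int j * p)"
    using p0 by (simp add: inj_def)
  then have inf: "infinite {\<theta>. cusp X \<theta>}"
    unfolding cusps using finite_imageD infinite_UNIV_int by blast
  have X0: "X \<theta>\<^sub>0 \<noteq> 0"
  proof
    assume "X \<theta>\<^sub>0 = 0"
    then have "Complex (- deriv h \<theta>\<^sub>0) (h \<theta>\<^sub>0) = 0"
      by (simp add: X support_curve_def)
    then have "h \<theta>\<^sub>0 = 0" "deriv h \<theta>\<^sub>0 = 0"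
      by (simp_all add: complex_eq_iff)
    then show False
      using support_ode_zero[OF h] nz by blast
  qed
  define E where "E = (\<lambda>\<theta>. exp (Complex (c/2) (1 + K) * of_real \<theta>))"
  define b where "b = (\<lambda>\<theta>. X \<theta>\<^sub>0 / E \<theta>\<^sub>0 * E \<theta>)"
  define q where "q = - of_real (exp (c / 2 * p)) * cis p"
  have exp_p: "exp (Complex (c/2) (1 + K) * of_real (\<theta> + p)) = q * exp (Complex (c/2) (1 + K) * of_real \<theta>)"
    "exp (Complex (c/2) (K + 1) * of_real (\<theta> + p)) = q * exp (Complex (c/2) (K + 1) * of_real \<theta>)"
    "exp (Complex (c/2) (1 - K) * of_real (\<theta> + p)) = q * exp (Complex (c/2) (1 - K) * of_real \<theta>)" for \<theta>
  proof -
    have "K * p = pi"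
      using K0 by (simp add: p_def)
    then have "cis ((1 + K) * p) = - cis p" "cis ((K + 1) * p) = - cis p" "cis ((1 - K) * p) = - cis p"
      by (simp_all add: algebra_simps complex_eq_iff cos_diff sin_diff)
    then have *: "exp (Complex (c/2) (1 + K) * of_real p) = q" "exp (Complex (c/2) (K + 1) * of_real p) = q"
      "exp (Complex (c/2) (1 - K) * of_real p) = q"
      by (simp_all add: exp_Complex_times_of_real q_def)
    show "exp (Complex (c/2) (1 + K) * of_real (\<theta> + p)) = q * exp (Complex (c/2) (1 + K) * of_real \<theta>)"
      "exp (Complex (c/2) (K + 1) * of_real (\<theta> + p)) = q * exp (Complex (c/2) (K + 1) * of_real \<theta>)"
      "exp (Complex (c/2) (1 - K) * of_real (\<theta> + p)) = q * exp (Complex (c/2) (1 - K) * of_real \<theta>)"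
      by (simp_all only: of_real_add distrib_left exp_add *) (simp_all only: mult.commute)
  qed
  have Xp: "X (\<theta> + p) = q * X \<theta>" and bp: "b (\<theta> + p) = q * b \<theta>" for \<theta>
    unfolding X_def b_def E_def exp_p by (simp_all only: distrib_left mult_ac)
  have b0: "b \<theta> \<noteq> 0" for \<theta>
    using X0 by (simp add: b_def E_def)
  have "q \<noteq> 0"
    by (simp add: q_def)
  have "cycloid_along X b"
    unfolding cycloid_along_def
  proof (rule exI[of _ \<theta>\<^sub>0], rule exI[of _ p], intro conjI allI impI)
    show "p > 0" "{\<theta>. cusp X \<theta>} = range (\<lambda>j::int. \<theta>\<^sub>0 + of_int j * p)"
      by (rule p0, rule cusps)
    show "X (\<theta> + p) = b (\<theta> + p) / b \<theta> * X \<theta>" for \<theta>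
      using b0[of \<theta>] by (simp add: Xp bp)
    fix \<theta> assume "cusp X \<theta>"
    then obtain j :: int where j: "\<theta> = \<theta>\<^sub>0 + of_int j * p"
      using cusps by blast
    have "X (t + p) / b (t + p) = X t / b t" for t
      using \<open>q \<noteq> 0\<close> by (simp add: Xp bp)
    then have "X \<theta> / b \<theta> = X \<theta>\<^sub>0 / b \<theta>\<^sub>0"
      unfolding j by (rule periodic_int_multiple[where f = "\<lambda>t. X t / b t"])
    also have "\<dots> = 1"
      using X0 by (simp add: b_def E_def)
    finally show "X \<theta> = b \<theta>"
      using b0[of \<theta>] by (simp add: field_simps)
  qed
  moreover have "if c = 0 then origin_circle b else logarithmic_spiral b"
  proof -
    have "X \<theta>\<^sub>0 / E \<theta>\<^sub>0 \<noteq> 0" "1 + K \<noteq> 0"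
      using X0 K0 by (auto simp: E_def)
    moreover have "b = (\<lambda>\<theta>. X \<theta>\<^sub>0 / E \<theta>\<^sub>0 * exp (Complex (c / 2) (1 + K) * of_real \<theta>))"
      by (simp add: b_def E_def)
    moreover have "c \<noteq> 0 \<Longrightarrow> c / 2 \<noteq> 0" "c = 0 \<Longrightarrow> c / 2 = 0"
      by simp_all
    ultimately show ?thesis
      unfolding origin_circle_def logarithmic_spiral_def by metis
  qed
  moreover have "tangent_angle_param X"
    unfolding X by (rule support_curve_tangent_angle_param[OF h]) simp
  ultimately show ?thesis
    using sol inf by blast
qed

section \<open>The critical case\<close>

text \<open>The quotient \<open>X / S\<close> is the affine function \<open>r \<theta> = (i - c/2) \<theta> - 1\<close>. Its relative increments
  tend to zero, so \<open>X\<close> has the local shape of \<open>S\<close>, although the two are not asymptotic in ratio.\<close>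

lemma classification_critical:
  fixes c d :: real
  assumes crit: "c\<^sup>2 = 4 * (1 - d)"
  defines "S \<equiv> (\<lambda>\<theta>. exp (Complex (c/2) 1 * of_real \<theta>))"
  defines "X \<equiv> (\<lambda>\<theta>. Complex (- c/2) 1 * of_real \<theta> * exp (Complex (c/2) 1 * of_real \<theta>)
                  - exp (Complex (c/2) 1 * of_real \<theta>))"
  shows "solutions_up_to_rot_scale c d [S, X] \<and> tangent_angle_param S \<and> tangent_angle_param X \<and>
          (if c = 0 then origin_circle S else logarithmic_spiral S) \<and>
          (\<exists>!\<theta>. cusp X \<theta>) \<and>
          (c \<noteq> 0 \<longrightarrow>
            (let F = (if c > 0 then at_bot else at_top)
             in (X \<longlongrightarrow> 0) F \<and> ((\<lambda>\<theta>. X \<theta> - S \<theta>) \<longlongrightarrow> 0) F \<and> asymptotic_shape F X S))"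
proof -
  have d: "d = 1 - c\<^sup>2 / 4"
    using crit by (simp add: field_simps)
  have cd: "(c, d) \<noteq> (0, 0)"
    using crit by auto
  define f where "f = (\<lambda>\<theta>. exp (c / 2 * \<theta>))"
  define g where "g = (\<lambda>\<theta>. exp (c / 2 * \<theta>) * \<theta>)"
  have root: "(c / 2)\<^sup>2 = c * (c / 2) - (1 - d)"
    by (simp add: d power2_eq_square)
  have f: "support_ode c d f" and f': "deriv f = (\<lambda>\<theta>. c / 2 * f \<theta>)"
    unfolding f_def by (rule support_ode_exp[OF root])+
  have CS: "((\<lambda>\<theta>. \<theta>) has_real_derivative 1) (at \<theta>)"
    "((\<lambda>\<theta>. 1) has_real_derivative (c\<^sup>2 / 4 + d - 1) * \<theta>) (at \<theta>)" for \<theta>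
    by (auto simp: d)
  have f1: "f = (\<lambda>\<theta>. exp (c / 2 * \<theta>) * 1)"
    by (simp add: f_def)
  have g: "support_ode c d g" and g': "deriv g = (\<lambda>\<theta>. c / 2 * g \<theta> + f \<theta>)"
    by (rule support_ode_exp_times(1,2)[OF CS g_def f1])+
  have nz: "f 0 \<noteq> 0" "g 1 \<noteq> 0"
    by (simp_all add: f_def g_def)
  define m where "m = inverse (Complex (- (c / 2)) 1)"
  have m: "m \<noteq> 0"
    by (simp add: m_def) (simp add: complex_eq_iff)
  have S: "S = (\<lambda>\<theta>. m * support_curve f \<theta>)"
    unfolding S_def m_def f_def by (rule ext, rule spiral_as_support_curve[OF root])
  have X: "X = (\<lambda>\<theta>. 1 * support_curve g \<theta>)"
    by (simp add: fun_eq_iff X_def support_curve_def g' exp_Complex_times_of_real)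
      (simp add: complex_eq_iff f_def g_def algebra_simps)
  have sol: "solutions_up_to_rot_scale c d [S, X]"
  proof (rule solutions_up_to_rot_scale_support_curves[OF cd, where hs = "[f, g]"])
    show "\<exists>m. m \<noteq> 0 \<and> [S, X] ! i = (\<lambda>\<theta>. m * support_curve ([f, g] ! i) \<theta>)" if "i < length [S, X]" for i
      using that S X m by (cases i) (auto intro: exI[of _ 1])
    show "support_ode c d ([f, g] ! i) \<and> (\<exists>\<theta>. ([f, g] ! i) \<theta> \<noteq> 0)" if "i < length [S, X]" for i
      using that f g nz by (cases i) auto
    have no_zero: "f \<theta> \<noteq> 0" for \<theta>
      by (simp add: f_def)
    have g0: "g 0 = 0"
      by (simp add: g_def)
    have fg: "f \<noteq> (\<lambda>\<theta>. \<mu> * g (\<theta> + k))" for \<mu> k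
    proof
      assume "f = (\<lambda>\<theta>. \<mu> * g (\<theta> + k))"
      then have "f (- k) = \<mu> * g (- k + k)" by (rule fun_cong)
      then show False using no_zero g0 by simp
    qed
    have gf: "g \<noteq> (\<lambda>\<theta>. \<mu> * f (\<theta> + k))" for \<mu> k
    proof
      assume eq: "g = (\<lambda>\<theta>. \<mu> * f (\<theta> + k))"
      then have "\<mu> * f (0 + k) = 0" using g0 by metis
      then have "\<mu> = 0" using no_zero by simp
      then show False using eq nz(2) by simp
    qed
    show "i = j" if "i < length [S, X]" "j < length [S, X]"
      and "[f, g] ! j = (\<lambda>\<theta>. \<mu> * ([f, g] ! i) (\<theta> + k))" for i j \<mu> k
    proof -
      have "i = 0 \<or> i = 1" "j = 0 \<or> j = 1"
        using that(1,2) by auto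
      then show ?thesis
        using that(3) fg[of \<mu> k] gf[of \<mu> k] by auto
    qed
    fix h assume h: "support_ode c d h"
    obtain A B where AB: "\<And>\<theta>. h \<theta> = exp (c / 2 * \<theta>) * (A * 1 + B * \<theta>)"
      using support_ode_general_solution[OF CS refl refl h] by metis
    show "\<exists>i < length [S, X]. \<exists>\<mu> k. h = (\<lambda>\<theta>. \<mu> * ([f, g] ! i) (\<theta> + k))"
    proof (cases "B = 0")
      case True
      then have "h = (\<lambda>\<theta>. A * ([f, g] ! 0) (\<theta> + 0))"
        by (simp add: AB f_def fun_eq_iff)
      moreover have "0 < length [S, X]"
        by simp
      ultimately show ?thesis by blast
    next
      case False
      then have "h = (\<lambda>\<theta>. B * exp (- (c / 2 * (A / B))) * g (\<theta> + A / B))"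
        by (simp add: AB g_def fun_eq_iff field_simps flip: exp_add)
      then show ?thesis
        by (intro exI[of _ 1]) auto
    qed
  qed
  have cusp_X: "\<exists>!\<theta>. cusp X \<theta>"
  proof -
    have pos: "c\<^sup>2 / 4 + 1 > 0"
      by (rule add_nonneg_pos) auto
    have "curvature_radius c d g \<theta> = exp (c / 2 * \<theta>) * (c + (c\<^sup>2 / 4 + 1) * \<theta>)" for \<theta>
      unfolding curvature_radius_def g' by (simp add: f_def g_def d field_simps power2_eq_square)
    moreover have "cusp X \<theta> \<longleftrightarrow> curvature_radius c d g \<theta> = 0" for \<theta>
      unfolding X by (rule cusp_support_curve_iff[OF cd g nz(2)]) simp
    ultimately have "cusp X \<theta> \<longleftrightarrow> c + (c\<^sup>2 / 4 + 1) * \<theta> = 0" for \<theta>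
      by simp
    also have "c + (c\<^sup>2 / 4 + 1) * \<theta> = 0 \<longleftrightarrow> \<theta> = - c / (c\<^sup>2 / 4 + 1)" for \<theta>
      using pos by (simp add: field_simps eq_neg_iff_add_eq_0)
    finally show ?thesis
      by simp
  qed
  have asym: "(X \<longlongrightarrow> 0) F \<and> ((\<lambda>\<theta>. X \<theta> - S \<theta>) \<longlongrightarrow> 0) F \<and> asymptotic_shape F X S"
    if c0: "c \<noteq> 0" and F: "F = (if c > 0 then at_bot else at_top)" for F
  proof -
    have lim: "((\<lambda>\<theta>. exp (c / 2 * \<theta>)) \<longlongrightarrow> 0) F" "((\<lambda>\<theta>. \<theta> * exp (c / 2 * \<theta>)) \<longlongrightarrow> 0) F"
      "((\<lambda>\<theta>. M / \<bar>\<theta>\<bar>) \<longlongrightarrow> 0) F" and ev: "\<forall>\<^sub>F \<theta> in F. \<theta> \<noteq> 0" for M :: real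
    proof -
      consider (pos) "c > 0" "F = at_bot" | (neg) "c < 0" "F = at_top"
        using c0 F by (cases "c > 0") simp_all
      then have "((\<lambda>\<theta>. exp (c / 2 * \<theta>)) \<longlongrightarrow> 0) F \<and> ((\<lambda>\<theta>. \<theta> * exp (c / 2 * \<theta>)) \<longlongrightarrow> 0) F \<and>
        ((\<lambda>\<theta>. M / \<bar>\<theta>\<bar>) \<longlongrightarrow> 0) F \<and> (\<forall>\<^sub>F \<theta> in F. \<theta> \<noteq> 0)"
      proof cases
        case pos
        have "((\<lambda>\<theta>. exp (c / 2 * \<theta>)) \<longlongrightarrow> 0) at_bot"
          using pos(1) by real_asymp
        moreover have "((\<lambda>\<theta>. \<theta> * exp (c / 2 * \<theta>)) \<longlongrightarrow> 0) at_bot"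
          using pos(1) by real_asymp
        moreover have "((\<lambda>\<theta>. M / \<bar>\<theta>\<bar>) \<longlongrightarrow> 0) at_bot"
          by real_asymp
        moreover have "\<forall>\<^sub>F \<theta> in at_bot. \<theta> \<noteq> (0 :: real)"
          by (rule eventually_mono[OF eventually_gt_at_bot[of 0]]) simp
        ultimately show ?thesis
          unfolding pos(2) by blast
      next
        case neg
        have "((\<lambda>\<theta>. exp (c / 2 * \<theta>)) \<longlongrightarrow> 0) at_top"
          using neg(1) by real_asymp
        moreover have "((\<lambda>\<theta>. \<theta> * exp (c / 2 * \<theta>)) \<longlongrightarrow> 0) at_top"
          using neg(1) by real_asymp
        moreover have "((\<lambda>\<theta>. M / \<bar>\<theta>\<bar>) \<longlongrightarrow> 0) at_top"
          by real_asymp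
        moreover have "\<forall>\<^sub>F \<theta> in at_top. \<theta> \<noteq> (0 :: real)"
          by (rule eventually_mono[OF eventually_gt_at_top[of 0]]) simp
        ultimately show ?thesis
          unfolding neg(2) by blast
      qed
      then show "((\<lambda>\<theta>. exp (c / 2 * \<theta>)) \<longlongrightarrow> 0) F" "((\<lambda>\<theta>. \<theta> * exp (c / 2 * \<theta>)) \<longlongrightarrow> 0) F"
        "((\<lambda>\<theta>. M / \<bar>\<theta>\<bar>) \<longlongrightarrow> 0) F" "\<forall>\<^sub>F \<theta> in F. \<theta> \<noteq> 0"
        by blast+
    qed
    let ?a = "Complex (- c/2) 1"
    have affine: "((\<lambda>\<theta>. (?a * of_real \<theta> + b) * exp (Complex (c/2) 1 * of_real \<theta>)) \<longlongrightarrow> 0) F" for b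
    proof (rule Lim_null_comparison)
      show "((\<lambda>\<theta>. norm ?a * \<bar>\<theta> * exp (c / 2 * \<theta>)\<bar> + norm b * exp (c / 2 * \<theta>)) \<longlongrightarrow> 0) F"
        using tendsto_add[OF tendsto_mult_left[OF tendsto_rabs[OF lim(2)], of "norm ?a"]
            tendsto_mult_left[OF lim(1), of "norm b"]] by simp
      have "norm ((?a * of_real \<theta> + b) * exp (Complex (c/2) 1 * of_real \<theta>))
          \<le> norm ?a * \<bar>\<theta> * exp (c / 2 * \<theta>)\<bar> + norm b * exp (c / 2 * \<theta>)" for \<theta>
      proof -
        have "norm (?a * of_real \<theta> + b) \<le> norm ?a * \<bar>\<theta>\<bar> + norm b"
          using norm_triangle_ineq[of "?a * of_real \<theta>" b] by (simp add: norm_mult)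
        then show ?thesis
          by (simp add: norm_mult abs_mult exp_Complex_times_of_real mult_right_mono
              flip: mult.assoc distrib_right)
      qed
      then show "\<forall>\<^sub>F \<theta> in F. norm ((?a * of_real \<theta> + b) * exp (Complex (c/2) 1 * of_real \<theta>))
          \<le> norm ?a * \<bar>\<theta> * exp (c / 2 * \<theta>)\<bar> + norm b * exp (c / 2 * \<theta>)"
        by simp
    qed
    have "(X \<longlongrightarrow> 0) F"
      using affine[of "- 1"] by (simp add: X_def algebra_simps)
    moreover have "((\<lambda>\<theta>. X \<theta> - S \<theta>) \<longlongrightarrow> 0) F"
      using affine[of "- 2"] by (simp add: X_def S_def algebra_simps)
    moreover have "asymptotic_shape F X S"
    proof (rule asymptotic_shapeI)
      let ?r = "\<lambda>\<theta>. ?a * complex_of_real \<theta> - 1"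
      have X_eq: "X \<theta> = ?r \<theta> * S \<theta>" for \<theta>
        by (simp add: X_def S_def algebra_simps)
      have S_add: "S (\<theta> + h) = S \<theta> * S h" and S0: "S \<theta> \<noteq> 0" for \<theta> h
        by (simp_all add: S_def distrib_left exp_add)
      have r_ge: "\<bar>\<theta>\<bar> \<le> norm (?r \<theta>)" for \<theta>
        using abs_Im_le_cmod[of "?r \<theta>"] by simp
      show "\<forall>\<^sub>F \<theta> in F. \<forall>h. X (\<theta> + h) / X \<theta> - S (\<theta> + h) / S \<theta> = (S h * of_real h) * (?a / ?r \<theta>)"
        using ev
      proof eventually_elim
        case (elim \<theta>)
        then have "?r \<theta> \<noteq> 0"
          using r_ge[of \<theta>] by auto
        moreover have "?r (\<theta> + h) = ?r \<theta> + ?a * of_real h" for h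
          by (simp add: algebra_simps)
        ultimately show ?case
          unfolding X_eq S_add using S0[of \<theta>] by (simp add: field_simps)
      qed
      show "continuous_on UNIV (\<lambda>h. S h * of_real h)"
        unfolding S_def by (intro continuous_intros)
      show "((\<lambda>\<theta>. ?a / ?r \<theta>) \<longlongrightarrow> 0) F"
      proof (rule Lim_null_comparison)
        show "((\<lambda>\<theta>. norm ?a / \<bar>\<theta>\<bar>) \<longlongrightarrow> 0) F"
          by (rule lim(3))
        show "\<forall>\<^sub>F \<theta> in F. norm (?a / ?r \<theta>) \<le> norm ?a / \<bar>\<theta>\<bar>"
          using ev
        proof eventually_elim
          case (elim \<theta>)
          then show ?case
            unfolding norm_divide using r_ge[of \<theta>] by (intro divide_left_mono mult_pos_pos) auto
        qed
      qed
    qed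
    ultimately show ?thesis by blast
  qed
  have "tangent_angle_param S"
    unfolding S by (rule support_curve_tangent_angle_param[OF f m])
  moreover have "tangent_angle_param X"
    unfolding X by (rule support_curve_tangent_angle_param[OF g]) simp
  moreover have "if c = 0 then origin_circle S else logarithmic_spiral S"
    using spiral_or_circle[of "c / 2"] by (cases "c = 0") (simp_all add: S_def)
  ultimately show ?thesis
    unfolding Let_def using sol cusp_X asym by blast
qed

section \<open>The overcritical case\<close>

text \<open>Linear independence of two exponentials, tested at the points \<open>0\<close> and \<open>1\<close>.\<close>

lemma exponential_pair_coefficients:
  fixes \<sigma> \<tau> :: real
  assumes "\<sigma> \<noteq> \<tau>" and "\<And>\<theta>. A * exp (\<sigma> * \<theta>) + B * exp (\<tau> * \<theta>) = A' * exp (\<sigma> * \<theta>) + B' * exp (\<tau> * \<theta>)"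
  shows "A = A'" "B = B'"
proof -
  have "A + B = A' + B'" "A * exp \<sigma> + B * exp \<tau> = A' * exp \<sigma> + B' * exp \<tau>"
    using assms(2)[of 0] assms(2)[of 1] by simp_all
  then have "(A - A') * (exp \<sigma> - exp \<tau>) = 0"
    by algebra
  then show "A = A'"
    using assms(1) by simp
  with \<open>A + B = A' + B'\<close> show "B = B'"
    by simp
qed

lemma smooth_curve_exponential_pair:
  assumes x: "x = (\<lambda>\<theta>. exp (z * of_real \<theta>) * a + exp (w * of_real \<theta>) * b)"
    and nz: "\<And>\<theta>. vector_derivative x (at \<theta>) \<noteq> 0"
  shows "smooth_curve x"
proof -
  define E where "E a b = (\<lambda>\<theta>. exp (z * complex_of_real \<theta>) * a + exp (w * of_real \<theta>) * b)" for a b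
  have E': "(E a b has_vector_derivative E (z * a) (w * b) \<theta>) (at \<theta>)" for a b \<theta>
  proof -
    have "((\<lambda>\<zeta>. exp (z * \<zeta>) * a + exp (w * \<zeta>) * b) has_field_derivative E (z * a) (w * b) \<theta>)
        (at (complex_of_real \<theta>))"
      unfolding E_def by (auto intro!: derivative_eq_intros)
    then show ?thesis
      unfolding E_def[of a b] by (rule has_vector_derivative_real_field)
  qed
  have "((\<lambda>f u. vector_derivative f (at u)) ^^ n) x = E (z ^ n * a) (w ^ n * b)" for n
  proof (induction n)
    case (Suc n)
    have "((\<lambda>f u. vector_derivative f (at u)) ^^ Suc n) x =
        (\<lambda>u. vector_derivative (E (z ^ n * a) (w ^ n * b)) (at u))"
      by (simp add: Suc)
    also have "\<dots> = E (z ^ Suc n * a) (w ^ Suc n * b)"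
      by (simp add: fun_eq_iff vector_derivative_at[OF E'] mult.assoc)
    finally show ?case .
  qed (simp add: x E_def)
  then show ?thesis
    unfolding smooth_curve_def using nz differentiableI_vector[OF E'] by simp
qed

text \<open>Up to rotation and scaling, \<open>S1\<close>, \<open>S2\<close>, \<open>X1\<close>, \<open>X2\<close> have support functions with the coefficient pairs \<open>(1, 0)\<close>,
  \<open>(0, 1)\<close>, \<open>(1, 1)\<close>, \<open>(1, -1)\<close>. The radius of curvature has the coefficients \<open>A (\<sigma>\<^sup>2 + 1)\<close> and
  \<open>B (\<tau>\<^sup>2 + 1)\<close>, because \<open>c \<lambda> + d = \<lambda>\<^sup>2 + 1\<close> for the characteristic roots. It is therefore positive for
  \<open>X1\<close> and has one zero for \<open>X2\<close>.\<close>

lemma classification_overcritical: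
  fixes c d :: real
  assumes over: "c\<^sup>2 > 4 * (1 - d)"
  defines "K \<equiv> sqrt (c\<^sup>2 / 4 + d - 1)"
  defines "S1 \<equiv> (\<lambda>\<theta>. exp (Complex (c/2 + K) 1 * of_real \<theta>))"
    and "S2 \<equiv> (\<lambda>\<theta>. exp (Complex (c/2 - K) 1 * of_real \<theta>))"
    and "X1 \<equiv> (\<lambda>\<theta>. exp (Complex (c/2 + K) 1 * of_real \<theta>) * Complex (- c/2 - K) 1
                   + exp (Complex (c/2 - K) 1 * of_real \<theta>) * Complex (- c/2 + K) 1)"
    and "X2 \<equiv> (\<lambda>\<theta>. exp (Complex (c/2 + K) 1 * of_real \<theta>) * Complex (- c/2 - K) 1
                   - exp (Complex (c/2 - K) 1 * of_real \<theta>) * Complex (- c/2 + K) 1)"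
  shows "solutions_up_to_rot_scale c d [S1, S2, X1, X2] \<and>
          (\<forall>Y \<in> {S1, S2, X1, X2}. tangent_angle_param Y) \<and>
          (if c/2 + K = 0 then origin_circle S1 else logarithmic_spiral S1) \<and>
          (if c/2 - K = 0 then origin_circle S2 else logarithmic_spiral S2) \<and>
          (\<forall>Y \<in> {X1, X2}.
             asymptotic_ratio at_top Y S1 \<and> asymptotic_shape at_top Y S1 \<and>
             asymptotic_ratio at_bot Y S2 \<and> asymptotic_shape at_bot Y S2) \<and>
          smooth_curve X1 \<and> (\<exists>!\<theta>. cusp X2 \<theta>)"
proof -
  have cd: "(c, d) \<noteq> (0, 0)"
    using over by auto
  have K0: "K > 0" and K2: "K\<^sup>2 = c\<^sup>2 / 4 + d - 1"
    using over by (simp_all add: K_def)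
  define \<sigma> \<tau> where "\<sigma> = c / 2 + K" and "\<tau> = c / 2 - K"
  have less: "\<tau> < \<sigma>"
    using K0 by (simp add: \<sigma>_def \<tau>_def)
  have root: "\<sigma>\<^sup>2 = c * \<sigma> - (1 - d)" "\<tau>\<^sup>2 = c * \<tau> - (1 - d)"
    using K2 by (simp_all add: \<sigma>_def \<tau>_def power2_eq_square field_simps)
  define h where "h = (\<lambda>A B \<theta>. A * exp (\<sigma> * \<theta>) + B * exp (\<tau> * \<theta>))"
  have h: "support_ode c d (h A B)" and h': "deriv (h A B) \<theta> = A * (\<sigma> * exp (\<sigma> * \<theta>)) + B * (\<tau> * exp (\<tau> * \<theta>))" for A B \<theta>
    using support_ode_lincomb[OF support_ode_exp(1)[OF root(1)] support_ode_exp(1)[OF root(2)], of A B]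
    by (simp_all add: h_def support_ode_exp(2)[OF root(1)] support_ode_exp(2)[OF root(2)])
  have h_inj: "A = A' \<and> B = B'" if "h A B = h A' B'" for A B A' B'
    using exponential_pair_coefficients[of \<sigma> \<tau> A B A' B'] less that by (auto simp: h_def fun_eq_iff)
  have h_nz: "\<exists>\<theta>. h A B \<theta> \<noteq> 0" if "A \<noteq> 0 \<or> B \<noteq> 0" for A B
  proof (rule ccontr)
    assume "\<nexists>\<theta>. h A B \<theta> \<noteq> 0"
    then have "h A B = h 0 0"
      by (simp add: fun_eq_iff h_def)
    then show False
      using h_inj that by blast
  qed
  have h_shift: "(\<lambda>\<theta>. \<mu> * h A B (\<theta> + k)) = h (\<mu> * exp (\<sigma> * k) * A) (\<mu> * exp (\<tau> * k) * B)" for \<mu> A B k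
    by (simp add: h_def fun_eq_iff algebra_simps exp_add)
  have h_sc: "support_curve (h A B) \<theta> = exp (Complex \<sigma> 1 * of_real \<theta>) * (of_real A * Complex (- \<sigma>) 1)
      + exp (Complex \<tau> 1 * of_real \<theta>) * (of_real B * Complex (- \<tau>) 1)" for A B \<theta>
  proof -
    have "Complex (- deriv (h A B) \<theta>) (h A B \<theta>) = of_real (exp (\<sigma> * \<theta>)) * (of_real A * Complex (- \<sigma>) 1)
      + of_real (exp (\<tau> * \<theta>)) * (of_real B * Complex (- \<tau>) 1)"
      unfolding h' by (simp add: complex_eq_iff h_def algebra_simps)
    then show ?thesis
      unfolding exp_Complex_times_of_real by (simp add: support_curve_def algebra_simps)
  qed
  define m1 m2 where "m1 = inverse (Complex (- \<sigma>) 1)" and "m2 = inverse (Complex (- \<tau>) 1)"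
  have m: "m1 \<noteq> 0" "m2 \<noteq> 0"
    by (simp_all add: m1_def m2_def) (simp_all add: complex_eq_iff)
  have "c / 2 + K = \<sigma>" "c / 2 - K = \<tau>" "- c / 2 - K = - \<sigma>" "- c / 2 + K = - \<tau>"
    by (simp_all add: \<sigma>_def \<tau>_def)
  note defs = S1_def[unfolded this] S2_def[unfolded this] X1_def[unfolded this] X2_def[unfolded this]
  have S1: "S1 = (\<lambda>\<theta>. m1 * support_curve (h 1 0) \<theta>)" and S2: "S2 = (\<lambda>\<theta>. m2 * support_curve (h 0 1) \<theta>)"
    using m by (simp_all add: fun_eq_iff defs h_sc m1_def m2_def)
  have X1: "X1 = (\<lambda>\<theta>. 1 * support_curve (h 1 1) \<theta>)" and X2: "X2 = (\<lambda>\<theta>. 1 * support_curve (h 1 (- 1)) \<theta>)"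
    by (simp_all add: fun_eq_iff defs h_sc)
  have less4: "i < length [S1, S2, X1, X2] \<longleftrightarrow> i = 0 \<or> i = 1 \<or> i = 2 \<or> i = 3" for i
    by auto
  have sol: "solutions_up_to_rot_scale c d [S1, S2, X1, X2]"
  proof (rule solutions_up_to_rot_scale_support_curves[OF cd, where hs = "[h 1 0, h 0 1, h 1 1, h 1 (- 1)]"])
    let ?hs = "[h 1 0, h 0 1, h 1 1, h 1 (- 1)]"
    show "\<exists>m. m \<noteq> 0 \<and> [S1, S2, X1, X2] ! i = (\<lambda>\<theta>. m * support_curve (?hs ! i) \<theta>)"
      if "i < length [S1, S2, X1, X2]" for i
      using that S1 S2 X1 X2 m unfolding less4
      by (elim disjE) (auto simp: numeral_2_eq_2 numeral_3_eq_3 intro: exI[of _ 1])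
    show "support_ode c d (?hs ! i) \<and> (\<exists>\<theta>. (?hs ! i) \<theta> \<noteq> 0)" if "i < length [S1, S2, X1, X2]" for i
      using that h h_nz unfolding less4
      by (elim disjE) (auto simp: numeral_2_eq_2 numeral_3_eq_3)
    show "i = j" if "i < length [S1, S2, X1, X2]" "j < length [S1, S2, X1, X2]"
      and eq: "?hs ! j = (\<lambda>\<theta>. \<mu> * (?hs ! i) (\<theta> + k))" for i j \<mu> k
    proof -
      \<comment> \<open>Invariants of the class: whether \<open>A\<close> vanishes, and the sign of \<open>A B\<close>.\<close>
      define A B :: "nat \<Rightarrow> real" where "A i = (if i = 1 then 0 else 1)"
        and "B i = (if i = 0 then 0 else if i = 3 then - 1 else 1)" for i
      have hs: "?hs ! i = h (A i) (B i)" if "i < length [S1, S2, X1, X2]" for i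
        using that unfolding less4
        by (elim disjE) (simp_all add: A_def B_def numeral_2_eq_2 numeral_3_eq_3)
      have AB: "A j = \<mu> * exp (\<sigma> * k) * A i" "B j = \<mu> * exp (\<tau> * k) * B i"
        using eq h_inj unfolding hs[OF that(1)] hs[OF that(2)] h_shift by blast+
      then have "A j * B j = \<mu>\<^sup>2 * (exp (\<sigma> * k) * exp (\<tau> * k)) * (A i * B i)"
        by (simp add: power2_eq_square mult_ac)
      moreover have "\<mu> \<noteq> 0"
        using AB by (auto simp: A_def B_def split: if_splits)
      ultimately have "sgn (A j * B j) = 1 * sgn (A i * B i)"
        by (simp only: sgn_mult[of "\<mu>\<^sup>2 * _"]) (simp add: sgn_1_pos)
      moreover have "A j = 0 \<longleftrightarrow> A i = 0"
        using AB(1) \<open>\<mu> \<noteq> 0\<close> by simp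
      ultimately show ?thesis
        using that(1,2) unfolding less4 by (auto simp: A_def B_def)
    qed
    fix g assume g: "support_ode c d g" and g_nz: "\<exists>\<theta>. g \<theta> \<noteq> 0"
    define A where "A = (deriv g 0 - \<tau> * g 0) / (\<sigma> - \<tau>)"
    define B where "B = g 0 - A"
    have gh: "g = h A B"
    proof (rule support_ode_unique[OF g h])
      show "g 0 = h A B 0"
        by (simp add: h_def B_def)
      have "A * (\<sigma> - \<tau>) = deriv g 0 - \<tau> * g 0"
        using less by (simp add: A_def)
      then show "deriv g 0 = deriv (h A B) 0"
        by (simp add: h' B_def algebra_simps)
    qed
    have "A \<noteq> 0 \<or> B \<noteq> 0"
      using g_nz by (auto simp: gh h_def)
    then consider "B = 0" | "A = 0" | "A \<noteq> 0" "B \<noteq> 0" "B / A > 0" | "A \<noteq> 0" "B \<noteq> 0" "B / A < 0"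
      by (metis divide_eq_0_iff linorder_neqE_linordered_idom)
    then show "\<exists>i < length [S1, S2, X1, X2]. \<exists>\<mu> k. g = (\<lambda>\<theta>. \<mu> * (?hs ! i) (\<theta> + k))"
    proof cases
      case 1
      have "g = (\<lambda>\<theta>. A * (?hs ! 0) (\<theta> + 0))"
        unfolding gh nth_Cons_0 h_shift by (simp add: 1)
      then show ?thesis by (metis less4)
    next
      case 2
      have "g = (\<lambda>\<theta>. B * (?hs ! 1) (\<theta> + 0))"
        unfolding gh One_nat_def nth_Cons_0 nth_Cons_Suc h_shift by (simp add: 2)
      then show ?thesis by (metis less4)
    next
      case 3
      \<comment> \<open>The translation \<open>k\<close> has to change the ratio of the coefficients from \<open>1\<close> to \<open>B / A\<close>.\<close>
      define k where "k = ln (B / A) / (\<tau> - \<sigma>)"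
      have "(\<tau> - \<sigma>) * k = ln (B / A)"
        using less by (simp add: k_def)
      then have "exp (\<tau> * k) / exp (\<sigma> * k) = B / A"
        using 3 by (simp add: left_diff_distrib flip: exp_diff)
      then have "h A B = h (A / exp (\<sigma> * k) * exp (\<sigma> * k) * 1) (A / exp (\<sigma> * k) * exp (\<tau> * k) * 1)"
        using 3 by (simp add: field_simps)
      then have "g = (\<lambda>\<theta>. A / exp (\<sigma> * k) * (?hs ! 2) (\<theta> + k))"
        unfolding gh numeral_2_eq_2 nth_Cons_0 nth_Cons_Suc h_shift .
      then show ?thesis by (metis less4)
    next
      case 4
      define k where "k = ln (- (B / A)) / (\<tau> - \<sigma>)"
      have "(\<tau> - \<sigma>) * k = ln (- (B / A))"
        using less by (simp add: k_def)
      then have "exp (\<tau> * k) / exp (\<sigma> * k) = - (B / A)"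
        using 4 by (simp add: left_diff_distrib flip: exp_diff)
      then have "h A B = h (A / exp (\<sigma> * k) * exp (\<sigma> * k) * 1) (A / exp (\<sigma> * k) * exp (\<tau> * k) * - 1)"
        using 4 by (simp add: field_simps)
      then have "g = (\<lambda>\<theta>. A / exp (\<sigma> * k) * (?hs ! 3) (\<theta> + k))"
        unfolding gh numeral_3_eq_3 nth_Cons_0 nth_Cons_Suc h_shift .
      then show ?thesis by (metis less4)
    qed
  qed
  have asym: "asymptotic_ratio at_top Y S1 \<and> asymptotic_shape at_top Y S1 \<and>
             asymptotic_ratio at_bot Y S2 \<and> asymptotic_shape at_bot Y S2"
    if "Y \<in> {X1, X2}" for Y
  proof -
    have "\<exists>b. b \<noteq> 0 \<and> Y = (\<lambda>\<theta>. exp (Complex \<sigma> 1 * of_real \<theta>) * Complex (- \<sigma>) 1 + exp (Complex \<tau> 1 * of_real \<theta>) * b)"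
    proof (cases "Y = X1")
      case True
      then show ?thesis
        by (intro exI[of _ "Complex (- \<tau>) 1"]) (simp add: defs complex_eq_iff)
    next
      case False
      then have "Y = X2" using that by blast
      then show ?thesis
        by (intro exI[of _ "- Complex (- \<tau>) 1"]) (simp add: defs complex_eq_iff)
    qed
    then obtain b where b: "b \<noteq> 0" and
      Y: "\<And>\<theta>. Y \<theta> = exp (Complex \<sigma> 1 * of_real \<theta>) * Complex (- \<sigma>) 1 + exp (Complex \<tau> 1 * of_real \<theta>) * b"
      by metis
    then have Y': "\<And>\<theta>. Y \<theta> = exp (Complex \<tau> 1 * of_real \<theta>) * b + exp (Complex \<sigma> 1 * of_real \<theta>) * Complex (- \<sigma>) 1"
      by (simp add: add.commute)
    have "((\<lambda>\<theta>. exp ((\<tau> - \<sigma>) * \<theta>)) \<longlongrightarrow> 0) at_top" "((\<lambda>\<theta>. exp ((\<sigma> - \<tau>) * \<theta>)) \<longlongrightarrow> 0) at_bot"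
      using less by real_asymp+
    then have lim: "((\<lambda>\<theta>. exp ((Complex \<tau> 1 - Complex \<sigma> 1) * of_real \<theta>)) \<longlongrightarrow> 0) at_top"
      "((\<lambda>\<theta>. exp ((Complex \<sigma> 1 - Complex \<tau> 1) * of_real \<theta>)) \<longlongrightarrow> 0) at_bot"
      by (auto intro!: exp_complex_tendsto_0)
    have "Complex (- \<sigma>) 1 \<noteq> 0"
      by (simp add: complex_eq_iff)
    then show ?thesis
      using asymptotic_dominant_exponential[OF _ lim(1) Y] asymptotic_dominant_exponential[OF b lim(2) Y']
      unfolding defs by blast
  qed
  have rad: "curvature_radius c d (h A B) \<theta> = A * (\<sigma>\<^sup>2 + 1) * exp (\<sigma> * \<theta>) + B * (\<tau>\<^sup>2 + 1) * exp (\<tau> * \<theta>)" for A B \<theta>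
    unfolding root curvature_radius_def h' by (simp add: h_def algebra_simps)
  have pos: "\<sigma>\<^sup>2 + 1 > 0" "\<tau>\<^sup>2 + 1 > 0"
    by (simp_all add: add_nonneg_pos)
  have "smooth_curve X1"
  proof (rule smooth_curve_exponential_pair[OF meta_eq_to_obj_eq[OF defs(3)]])
    fix \<theta>
    have "curvature_radius c d (h 1 1) \<theta> > 0"
      unfolding rad using pos by (simp add: add_pos_pos)
    then show "vector_derivative X1 (at \<theta>) \<noteq> 0"
      unfolding X1 vector_derivative_at[OF support_curve_has_vector_derivative[OF h]] by simp
  qed
  moreover have "\<exists>!\<theta>. cusp X2 \<theta>"
  proof -
    obtain \<theta>\<^sub>0 where "h 1 (- 1) \<theta>\<^sub>0 \<noteq> 0"
      using h_nz[of 1 "- 1"] by auto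
    then have "cusp X2 \<theta> \<longleftrightarrow> curvature_radius c d (h 1 (- 1)) \<theta> = 0" for \<theta>
      unfolding X2 by (rule cusp_support_curve_iff[OF cd h]) simp
    also have "curvature_radius c d (h 1 (- 1)) \<theta> = 0 \<longleftrightarrow> \<theta> = ln ((\<tau>\<^sup>2 + 1) / (\<sigma>\<^sup>2 + 1)) / (\<sigma> - \<tau>)" for \<theta>
    proof -
      have "curvature_radius c d (h 1 (- 1)) \<theta> = 0 \<longleftrightarrow>
          (\<sigma>\<^sup>2 + 1) * exp (\<sigma> * \<theta>) = (\<tau>\<^sup>2 + 1) * exp (\<tau> * \<theta>)"
        unfolding rad by (simp add: algebra_simps)
      also have "\<dots> \<longleftrightarrow> exp ((\<sigma> - \<tau>) * \<theta>) = (\<tau>\<^sup>2 + 1) / (\<sigma>\<^sup>2 + 1)"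
        using pos by (simp add: left_diff_distrib exp_diff field_simps)
      also have "\<dots> \<longleftrightarrow> (\<sigma> - \<tau>) * \<theta> = ln ((\<tau>\<^sup>2 + 1) / (\<sigma>\<^sup>2 + 1))"
        using pos by (metis divide_pos_pos exp_ln ln_exp)
      finally show ?thesis
        using less by (simp add: field_simps)
    qed
    finally show ?thesis by simp
  qed
  moreover have "\<forall>Y \<in> {S1, S2, X1, X2}. tangent_angle_param Y"
  proof -
    have "tangent_angle_param S1"
      unfolding S1 by (rule support_curve_tangent_angle_param[OF h m(1)])
    moreover have "tangent_angle_param S2"
      unfolding S2 by (rule support_curve_tangent_angle_param[OF h m(2)])
    moreover have "tangent_angle_param X1"
      unfolding X1 by (rule support_curve_tangent_angle_param[OF h one_neq_zero])
    moreover have "tangent_angle_param X2"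
      unfolding X2 by (rule support_curve_tangent_angle_param[OF h one_neq_zero])
    ultimately show ?thesis by blast
  qed
  moreover have "if c/2 + K = 0 then origin_circle S1 else logarithmic_spiral S1"
    "if c/2 - K = 0 then origin_circle S2 else logarithmic_spiral S2"
    unfolding S1_def S2_def by (rule spiral_or_circle)+
  ultimately show ?thesis
    using sol asym by blast
qed

section \<open>The classification\<close>

theorem theorem1p4:
  fixes c d :: real
  assumes "(c, d) \<noteq> (0, 0)"
  shows
   "(c^2 < 4 * (1 - d) \<longrightarrow>
      (let K = sqrt (1 - d - c^2 / 4);
           X = (\<lambda>\<theta>. exp (Complex (c/2) (K + 1) * of_real \<theta>) * Complex (- c/2) (1 - K)
                  + exp (Complex (c/2) (1 - K) * of_real \<theta>) * Complex (- c/2) (1 + K))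
       in solutions_up_to_rot_scale c d [X] \<and> tangent_angle_param X \<and>
          (\<exists>b. (if c = 0 then origin_circle b else logarithmic_spiral b) \<and> cycloid_along X b) \<and>
          infinite {\<theta>. cusp X \<theta>})) \<and>
    (c^2 = 4 * (1 - d) \<longrightarrow>
      (let S = (\<lambda>\<theta>. exp (Complex (c/2) 1 * of_real \<theta>));
           X = (\<lambda>\<theta>. Complex (- c/2) 1 * of_real \<theta> * exp (Complex (c/2) 1 * of_real \<theta>)
                  - exp (Complex (c/2) 1 * of_real \<theta>))
       in solutions_up_to_rot_scale c d [S, X] \<and> tangent_angle_param S \<and> tangent_angle_param X \<and>
          (if c = 0 then origin_circle S else logarithmic_spiral S) \<and>
          (\<exists>!\<theta>. cusp X \<theta>) \<and>
          (c \<noteq> 0 \<longrightarrow>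
            (let F = (if c > 0 then at_bot else at_top)
             in (X \<longlongrightarrow> 0) F \<and> ((\<lambda>\<theta>. X \<theta> - S \<theta>) \<longlongrightarrow> 0) F \<and> asymptotic_shape F X S)))) \<and>
    (c^2 > 4 * (1 - d) \<longrightarrow>
      (let K = sqrt (c^2 / 4 + d - 1);
           S1 = (\<lambda>\<theta>. exp (Complex (c/2 + K) 1 * of_real \<theta>));
           S2 = (\<lambda>\<theta>. exp (Complex (c/2 - K) 1 * of_real \<theta>));
           X1 = (\<lambda>\<theta>. exp (Complex (c/2 + K) 1 * of_real \<theta>) * Complex (- c/2 - K) 1
                   + exp (Complex (c/2 - K) 1 * of_real \<theta>) * Complex (- c/2 + K) 1);
           X2 = (\<lambda>\<theta>. exp (Complex (c/2 + K) 1 * of_real \<theta>) * Complex (- c/2 - K) 1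
                   - exp (Complex (c/2 - K) 1 * of_real \<theta>) * Complex (- c/2 + K) 1)
       in solutions_up_to_rot_scale c d [S1, S2, X1, X2] \<and>
          (\<forall>Y \<in> {S1, S2, X1, X2}. tangent_angle_param Y) \<and>
          (if c/2 + K = 0 then origin_circle S1 else logarithmic_spiral S1) \<and>
          (if c/2 - K = 0 then origin_circle S2 else logarithmic_spiral S2) \<and>
          (\<forall>Y \<in> {X1, X2}.
             asymptotic_ratio at_top Y S1 \<and> asymptotic_shape at_top Y S1 \<and>
             asymptotic_ratio at_bot Y S2 \<and> asymptotic_shape at_bot Y S2) \<and>
          smooth_curve X1 \<and> (\<exists>!\<theta>. cusp X2 \<theta>)))"
  unfolding Let_def
  using classification_undercritical[OF assms] classification_critical[of c d, unfolded Let_def]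
    classification_overcritical[of d c]
  by blast

end
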